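(* Let $1\le p<\infty$. The inclusion map $W^{1,p}\hookrightarrow L^p([0,1])$ is polynomial-time computable, where $W^{1,p}$ carries the representation $\xi_{1,p}$ and $L^p([0,1])$ carries $\xi_{0,p}$.
   Context: Framework. $\Sigma=\{0,1\}$, $|a|$ string length, $1^n$ unary string. Fix a bijective pairing $\langle\cdot,\cdot\rangle$ on $\Sigma^*$, polynomial-time computable with polynomial-time projections, monotone in both arguments (iterated for tuples), and an encoding $a\mapsto[\![a]\!]$ of dyadic rationals by strings (binary expansion allowing arbitrarily long codes). A string function $\varphi$ is length-monotone if $|a|\le|b|\Rightarrow|\varphi(a)|\le|\varphi(b)|$; its size is $|\varphi|(|a|):=|\varphi(a)|$. A second-order representation of $X$ is a partial surjection from length-monotone string functions onto $X$. Second-order polynomials: smallest class of $P:\mathbb{N}^{\mathbb{N}}\times\mathbb{N}\to\mathbb{N}$ containing $(l,n)\mapsto p(n)$ for integer polynomials $p$, closed under $+,\cdot$ and $P\mapsto((l,n)\mapsto l(P(l,n)))$. A map $f:X\to Y$ of represented spaces is polynomial-time computable if there are an oracle Turing machine $M$ and a second-order polynomial $P$ such that whenever $\varphi$ names $x$, $a\mapsto M^\varphi(a)$ names $f(x)$, and $M^\varphi(a)$ halts within $P(|\varphi|,|a|)$ steps. Weak derivative of $f\in L^1([0,1])$: $f'\in L^1$ with $\int fg'=-\int f'g$ for all $g\in C^\infty([0,1])$, $g(0)=g(1)=0$; $f^{(k)}$ is the $k$-fold iterate. $W^{m,p}$ is the set of $f\in L^p([0,1])$ with weak derivatives $f',\dots,f^{(m)}$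 existing in $L^p$. $\tilde g$ is $g$ extended by zero to $\mathbb{R}$, $(\tau_hg)(x)=g(x+h)$. An $L^p$-modulus of $g\in L^p([0,1])$ is $\mu:\mathbb{N}\to\mathbb{N}$ with $|h|\le2^{-\mu(n)}\Rightarrow\|\tilde g-\tau_h\tilde g\|_p<2^{-n}$ for all $n,h$, and $\mu(n)\ne0\Rightarrow\mu(n+1)>\mu(n)$. Representation $\xi_{m,p}$ of $W^{m,p}$: a length-monotone $\varphi$ names $f$ iff for all strings $a,b$ with $[\![a]\!],[\![b]\!]\in[0,1]$ and all $n$, $\left|\int_{[\![a]\!]}^{[\![b]\!]}f\,d\lambda-[\![\varphi(\langle a,b,1^n\rangle)]\!]\right|<2^{-n}$, and $|\varphi|$ is an $L^p$-modulus of $f^{(m)}$ (for $m=0$, of $f$; $W^{0,p}=L^p([0,1])$). *)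

theory Defs
  imports "HOL-Analysis.Analysis" "HOL-Computational_Algebra.Polynomial"
begin

section \<open>Strings and string functions\<close>

text \<open>The letters 0 and 1 are \<^term>\<open>False\<close> and \<^term>\<open>True\<close>.\<close>

type_synonym str = "bool list"
type_synonym strfun = "str \<Rightarrow> str"

definition ones :: "nat \<Rightarrow> str" where
  "ones n = replicate n True"

definition length_monotone :: "strfun \<Rightarrow> bool" where
  "length_monotone \<phi> \<longleftrightarrow> (\<forall>a b. length a \<le> length b \<longrightarrow> length (\<phi> a) \<le> length (\<phi> b))"

text \<open>For length-monotone \<^term>\<open>\<phi>\<close> the length of \<^term>\<open>\<phi> a\<close> depends only on the length
  of \<^term>\<open>a\<close>, so evaluating at \<^term>\<open>ones n\<close> is no restriction.\<close>

definition fun_size :: "strfun \<Rightarrow> nat \<Rightarrow> nat" where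
  "fun_size \<phi> n = length (\<phi> (ones n))"

text \<open>A code consists of a sign bit, a block \<open>1\<^sup>k0\<close>, and the digits of a binary expansion, of which
  the first \<open>k\<close> stand before the binary point (missing digits are zeros). Every string is a code,
  and appending zeros never changes the value.\<close>

fun dyadic :: "str \<Rightarrow> real" where
  "dyadic [] = 0"
| "dyadic (s # w) =
    (let k = length (takeWhile id w); d = drop (Suc k) w
     in (if s then - 1 else 1) * 2 ^ k * (\<Sum>i<length d. of_bool (d ! i) / 2 ^ Suc i))"

section \<open>Oracle Turing machines\<close>

text \<open>Deterministic multi-tape machines with two-way infinite tapes. States and tape symbols are
  initial segments of the natural numbers. Symbol 0 is the blank, symbols 1 and 2 are the letters
  0 and 1. State 0 is initial, state 1 is halting, state 2 is the query state, and state 3 is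
  entered after a query. Tape 0 is the input tape, tape 1 the output tape, tape 2 the query tape,
  tape 3 the answer tape; all others are work tapes.\<close>

datatype head_move = Move_Left | Stay | Move_Right

record machine =
  num_tapes :: nat
  num_states :: nat
  num_symbols :: nat
  trans :: "nat \<Rightarrow> nat list \<Rightarrow> nat \<times> (nat \<times> head_move) list"

definition wf_machine :: "machine \<Rightarrow> bool" where
  "wf_machine M \<longleftrightarrow> 4 \<le> num_tapes M \<and> 4 \<le> num_states M \<and> 3 \<le> num_symbols M \<and>
    (\<forall>q < num_states M. \<forall>ss. length ss = num_tapes M \<and> (\<forall>s\<in>set ss. s < num_symbols M) \<longrightarrow>
      (case trans M q ss of (q', acts) \<Rightarrow>
        q' < num_states M \<and> length acts = num_tapes M \<and> (\<forall>(s, m)\<in>set acts. s < num_symbols M)))"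

definition oracle_free :: "machine \<Rightarrow> bool" where
  "oracle_free M \<longleftrightarrow>
    (\<forall>q < num_states M. \<forall>ss. length ss = num_tapes M \<and> (\<forall>s\<in>set ss. s < num_symbols M) \<longrightarrow>
      fst (trans M q ss) \<noteq> 2)"

type_synonym tape = "int \<times> (int \<Rightarrow> nat)"  (* head position, contents *)
type_synonym config = "nat \<times> tape list"

definition blank_tape :: tape where
  "blank_tape = (0, \<lambda>_. 0)"

definition letter :: "bool \<Rightarrow> nat" where
  "letter b = (if b then 2 else 1)"

definition symbols_tape :: "nat list \<Rightarrow> tape" where
  "symbols_tape ss = (0, \<lambda>i. if 0 \<le> i \<and> nat i < length ss then ss ! nat i else 0)"

definition string_tape :: "str \<Rightarrow> tape" where
  "string_tape a = symbols_tape (map letter a)"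

text \<open>The string on a tape: the letters from cell 0 up to the first cell not holding a letter.\<close>

definition tape_string :: "tape \<Rightarrow> str" where
  "tape_string t =
    map (\<lambda>i. snd t (int i) = letter True) [0..<(LEAST n. snd t (int n) \<notin> range letter)]"

definition tape_read :: "tape \<Rightarrow> nat" where
  "tape_read t = snd t (fst t)"

fun tape_act :: "nat \<times> head_move \<Rightarrow> tape \<Rightarrow> tape" where
  "tape_act (s, m) (h, c) =
    (case m of Move_Left \<Rightarrow> h - 1 | Stay \<Rightarrow> h | Move_Right \<Rightarrow> h + 1, c(h := s))"

text \<open>A query takes one step: it erases the query tape and puts the oracle's answer on the
  answer tape, with both heads reset to cell 0.\<close>

fun step :: "machine \<Rightarrow> strfun \<Rightarrow> config \<Rightarrow> config" where
  "step M \<phi> (q, ts) =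
    (if q = 1 then (q, ts)
     else if q = 2 then (3, ts[2 := blank_tape, 3 := string_tape (\<phi> (tape_string (ts ! 2)))])
     else (case trans M q (map tape_read ts) of (q', acts) \<Rightarrow> (q', map2 tape_act acts ts)))"

text \<open>Several input strings are separated by single blanks on the input tape.\<close>

fun input_symbols :: "str list \<Rightarrow> nat list" where
  "input_symbols [] = []"
| "input_symbols [a] = map letter a"
| "input_symbols (a # as) = map letter a @ 0 # input_symbols as"

definition init_config :: "machine \<Rightarrow> str list \<Rightarrow> config" where
  "init_config M as = (0, symbols_tape (input_symbols as) # replicate (num_tapes M - 1) blank_tape)"

definition computes_within :: "machine \<Rightarrow> strfun \<Rightarrow> str list \<Rightarrow> str \<Rightarrow> nat \<Rightarrow> bool" where
  "computes_within M \<phi> as b t \<longleftrightarrow>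
    (\<exists>n\<le>t. case (step M \<phi> ^^ n) (init_config M as) of (q, ts) \<Rightarrow>
      q = 1 \<and> tape_string (ts ! 1) = b)"

section \<open>Pairing functions\<close>

text \<open>The oracle passed to an \<^const>\<open>oracle_free\<close> machine is irrelevant.\<close>

definition polytime_unary :: "(str \<Rightarrow> str) \<Rightarrow> bool" where
  "polytime_unary f \<longleftrightarrow> (\<exists>M (r :: nat poly). wf_machine M \<and> oracle_free M \<and>
    (\<forall>a. computes_within M (\<lambda>_. []) [a] (f a) (poly r (length a))))"

definition polytime_binary :: "(str \<Rightarrow> str \<Rightarrow> str) \<Rightarrow> bool" where
  "polytime_binary f \<longleftrightarrow> (\<exists>M (r :: nat poly). wf_machine M \<and> oracle_free M \<and>
    (\<forall>a b. computes_within M (\<lambda>_. []) [a, b] (f a b) (poly r (length a + length b))))"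

text \<open>Monotonicity refers to the length-lexicographic order, i.e. to the usual order of the natural
  numbers under their standard identification with binary strings; Cantor's pairing function is an
  instance. (No bijective pairing is monotone with respect to lengths alone: the number of pairs
  with image of length \<open>n\<close> would have to be a sum of terms \<open>2\<^bsup>i+j\<^esup>\<close> for the length pairs \<open>(i, j)\<close>
  mapped to \<open>n\<close>, and this fails for one of \<open>(0, 1)\<close> and \<open>(1, 0)\<close>.)\<close>

definition str_le :: "str \<Rightarrow> str \<Rightarrow> bool" where
  "str_le a b \<longleftrightarrow> a = b \<or> (a, b) \<in> lenlex {(False, True)}"

definition pairing_function :: "(str \<Rightarrow> str \<Rightarrow> str) \<Rightarrow> bool" where
  "pairing_function pr \<longleftrightarrow>
    bij (\<lambda>(a, b). pr a b) \<and>
    polytime_binary pr \<and>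
    polytime_unary (\<lambda>c. fst (inv (\<lambda>(a, b). pr a b) c)) \<and>
    polytime_unary (\<lambda>c. snd (inv (\<lambda>(a, b). pr a b) c)) \<and>
    (\<forall>a a' b. str_le a a' \<longrightarrow> str_le (pr a b) (pr a' b)) \<and>
    (\<forall>a b b'. str_le b b' \<longrightarrow> str_le (pr a b) (pr a b'))"

definition triple :: "(str \<Rightarrow> str \<Rightarrow> str) \<Rightarrow> str \<Rightarrow> str \<Rightarrow> str \<Rightarrow> str" where
  "triple pr a b c = pr a (pr b c)"

section \<open>Second-order polynomial time\<close>

inductive second_order_poly :: "((nat \<Rightarrow> nat) \<Rightarrow> nat \<Rightarrow> nat) \<Rightarrow> bool" where
  base: "(\<And>n :: nat. 0 \<le> poly r (int n)) \<Longrightarrow> second_order_poly (\<lambda>l n. nat (poly r (int n)))"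
| add: "second_order_poly P \<Longrightarrow> second_order_poly Q \<Longrightarrow> second_order_poly (\<lambda>l n. P l n + Q l n)"
| mult: "second_order_poly P \<Longrightarrow> second_order_poly Q \<Longrightarrow> second_order_poly (\<lambda>l n. P l n * Q l n)"
| app: "second_order_poly P \<Longrightarrow> second_order_poly (\<lambda>l n. l (P l n))"

text \<open>A representation is given by the relation ``\<open>\<phi>\<close> is a name of \<open>x\<close>''.\<close>

type_synonym 'x naming = "strfun \<Rightarrow> 'x \<Rightarrow> bool"

definition polytime_computable_map ::
  "'x set \<Rightarrow> 'x naming \<Rightarrow> 'y set \<Rightarrow> 'y naming \<Rightarrow> ('x \<Rightarrow> 'y) \<Rightarrow> bool" where
  "polytime_computable_map X \<delta> Y \<epsilon> f \<longleftrightarrow> (\<forall>x\<in>X. f x \<in> Y) \<and>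
    (\<exists>M P. wf_machine M \<and> second_order_poly P \<and>
      (\<forall>\<phi>. \<forall>x\<in>X. \<delta> \<phi> x \<longrightarrow>
        (\<exists>\<psi>. \<epsilon> \<psi> (f x) \<and>
          (\<forall>a. computes_within M \<phi> [a] (\<psi> a) (P (fun_size \<phi>) (length a))))))"

section \<open>Lebesgue and Sobolev spaces on the unit interval\<close>

definition Lp_funs :: "real \<Rightarrow> (real \<Rightarrow> real) set" where
  "Lp_funs p = {f. f \<in> borel_measurable (lebesgue_on {0..1}) \<and>
    integrable (lebesgue_on {0..1}) (\<lambda>x. \<bar>f x\<bar> powr p)}"

definition ae_eq :: "real \<Rightarrow> ((real \<Rightarrow> real) \<times> (real \<Rightarrow> real)) set" where
  "ae_eq p = {(f, g). f \<in> Lp_funs p \<and> g \<in> Lp_funs p \<and> (AE x in lebesgue_on {0..1}. f x = g x)}"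

definition Lp_space :: "real \<Rightarrow> (real \<Rightarrow> real) set set" where
  "Lp_space p = Lp_funs p // ae_eq p"

text \<open>\<open>D\<close> is the sequence of derivatives (one-sided at the end points) of a function in
  \<open>C\<^sup>\<infinity>([0,1])\<close> that vanishes at both end points.\<close>

definition test_function :: "(nat \<Rightarrow> real \<Rightarrow> real) \<Rightarrow> bool" where
  "test_function D \<longleftrightarrow>
    (\<forall>k. \<forall>x\<in>{0..1}. (D k has_real_derivative D (Suc k) x) (at x within {0..1})) \<and>
    D 0 0 = 0 \<and> D 0 1 = 0"

definition weak_derivative :: "(real \<Rightarrow> real) \<Rightarrow> (real \<Rightarrow> real) \<Rightarrow> bool" where
  "weak_derivative f f' \<longleftrightarrow> f \<in> Lp_funs 1 \<and> f' \<in> Lp_funs 1 \<and>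
    (\<forall>D. test_function D \<longrightarrow>
      (LINT x|lebesgue_on {0..1}. f x * D 1 x) = - (LINT x|lebesgue_on {0..1}. f' x * D 0 x))"

definition sobolev_space :: "nat \<Rightarrow> real \<Rightarrow> (real \<Rightarrow> real) set set" where
  "sobolev_space m p = {F \<in> Lp_space p. \<exists>f\<in>F. \<forall>k\<in>{1..m}. \<exists>g\<in>Lp_funs p. (weak_derivative ^^ k) f g}"

definition Lp_norm_line :: "real \<Rightarrow> (real \<Rightarrow> real) \<Rightarrow> real" where
  "Lp_norm_line p f = (LINT x|lebesgue. \<bar>f x\<bar> powr p) powr (1 / p)"

definition zero_extension :: "(real \<Rightarrow> real) \<Rightarrow> real \<Rightarrow> real" where
  "zero_extension g x = (if x \<in> {0..1} then g x else 0)"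

definition Lp_modulus :: "real \<Rightarrow> (real \<Rightarrow> real) \<Rightarrow> (nat \<Rightarrow> nat) \<Rightarrow> bool" where
  "Lp_modulus p g \<mu> \<longleftrightarrow> g \<in> Lp_funs p \<and>
    (\<forall>n h. \<bar>h\<bar> \<le> 1 / 2 ^ \<mu> n \<longrightarrow>
      Lp_norm_line p (\<lambda>x. zero_extension g x - zero_extension g (x + h)) < 1 / 2 ^ n) \<and>
    (\<forall>n. \<mu> n \<noteq> 0 \<longrightarrow> \<mu> n < \<mu> (Suc n))"

text \<open>The two conditions on the representative \<open>f\<close> are invariant under changes on null sets, and
  the \<open>m\<close>-fold weak derivative is unique up to null sets. The integral is the oriented one.\<close>

definition xi :: "(str \<Rightarrow> str \<Rightarrow> str) \<Rightarrow> nat \<Rightarrow> real \<Rightarrow> (real \<Rightarrow> real) set naming" where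
  "xi pr m p \<phi> F \<longleftrightarrow> F \<in> sobolev_space m p \<and> length_monotone \<phi> \<and>
    (\<exists>f\<in>F.
      (\<forall>a b n. dyadic a \<in> {0..1} \<and> dyadic b \<in> {0..1} \<longrightarrow>
        \<bar>(LINT x=ereal (dyadic a)..ereal (dyadic b)|lebesgue. f x)
          - dyadic (\<phi> (triple pr a b (ones n)))\<bar> < 1 / 2 ^ n) \<and>
      (\<exists>g. (weak_derivative ^^ m) f g \<and> Lp_modulus p g (fun_size \<phi>)))"

end

theory Submission
  imports Defs
begin

text \<open>
  A function \<open>f\<close> in \<open>W\<^bsup>1,p\<^esup>\<close> agrees almost everywhere with a primitive \<open>c + \<integral> g\<close> of its weak
  derivative \<open>g\<close>. A modulus \<open>\<mu>\<close> of \<open>g\<close> bounds \<open>\<parallel>g\<parallel>\<^sub>1\<close> by \<open>6 \<cdot> 2\<^bsup>\<mu>(0)\<^esup>\<close>, since the support of the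
  zero extension is left after \<open>2 \<cdot> 2\<^bsup>\<mu>(0)\<^esup>\<close> translations by \<open>2\<^bsup>-\<mu>(0)\<^esup>\<close>; together with one value of
  \<open>\<integral>f\<close> this bounds \<open>\<bar>f\<bar>\<close> by some \<open>B\<close>, exponential in the size of the name. The zero extension
  of \<open>f\<close> has total variation at most \<open>2 B + \<parallel>g\<parallel>\<^sub>1\<close>, so a translation by \<open>h\<close> moves it in \<open>L\<^sup>1\<close> by at
  most \<open>\<bar>h\<bar> (2 B + \<parallel>g\<parallel>\<^sub>1)\<close>, hence in \<open>L\<^sup>p\<close> by \<open>O(\<bar>h\<bar>\<^bsup>1/p\<^esup> B)\<close>. Therefore a linear function of \<open>n\<close>
  and the size of the name is an \<open>L\<^sup>p\<close>-modulus of \<open>f\<close>. The approximations of the integrals can be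
  kept, so all the machine does is to pad each answer with zeros to the required length.
\<close>

section \<open>Straight-line oracle machines\<close>

declare tape_act.simps [simp del] step.simps [simp del]

datatype instr = Put nat bool | Scan head_move nat nat "bool \<Rightarrow> bool" | Query

fun reverse_move :: "head_move \<Rightarrow> head_move" where
  "reverse_move Move_Left = Move_Right"
| "reverse_move Stay = Stay"
| "reverse_move Move_Right = Move_Left"

definition idle :: "nat list \<Rightarrow> (nat \<times> head_move) list" where
  "idle ss = map (\<lambda>s. (s, Stay)) ss"

text \<open>State \<open>4 + i\<close> executes instruction \<open>i\<close>. As every query returns to state 3, the return address
  is left as a symbol on tape 4. A scan stops at the first blank and then steps back, so that the
  same tape can next be scanned in the opposite direction.\<close>

definition instr_trans :: "instr \<Rightarrow> nat \<Rightarrow> nat list \<Rightarrow> nat \<times> (nat \<times> head_move) list" where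
  "instr_trans c i ss = (case c of
     Put t b \<Rightarrow> (5 + i, (idle ss)[t := (letter b, Move_Right)])
   | Scan d s t f \<Rightarrow>
      (if ss ! s = 0 then (5 + i, (idle ss)[s := (0, reverse_move d)])
       else (4 + i, (idle ss)[s := (letter (ss ! s = letter True), d),
                              t := (letter (f (ss ! s = letter True)), Move_Right)]))
   | Query \<Rightarrow> (2, (idle ss)[4 := (Suc i, Stay)]))"

definition compile :: "instr list \<Rightarrow> machine" where
  "compile cs = \<lparr>num_tapes = 5, num_states = 7 + length cs, num_symbols = 3 + length cs,
     trans = (\<lambda>q ss. if q = 0 then (4, idle ss)
                    else if q = 3 then (4 + ss ! 4, (idle ss)[4 := (0, Stay)])
                    else if 4 \<le> q \<and> q - 4 < length cs then instr_trans (cs ! (q - 4)) (q - 4) ss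
                    else (1, idle ss))\<rparr>"

lemma compile_sizes:
  "num_tapes (compile cs) = 5" "num_states (compile cs) = 7 + length cs"
  "num_symbols (compile cs) = 3 + length cs"
  by (simp_all add: compile_def)

lemma length_idle [simp]: "length (idle ss) = length ss"
  by (simp add: idle_def)

definition symbols_below :: "nat \<Rightarrow> (nat \<times> head_move) list \<Rightarrow> bool" where
  "symbols_below N acts \<longleftrightarrow> (\<forall>(s, m)\<in>set acts. s < N)"

lemma symbols_below_idle: "\<forall>s\<in>set ss. s < N \<Longrightarrow> symbols_below N (idle ss)"
  by (auto simp: symbols_below_def idle_def)

lemma symbols_below_update:
  assumes "symbols_below N acts" "s < N"
  shows "symbols_below N (acts[i := (s, m)])"
  using assms set_update_subset_insert[of acts i "(s, m)"] by (fastforce simp: symbols_below_def)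

lemma letter_less_3: "letter b < 3 + n"
  by (simp add: letter_def)

lemma instr_trans_bounded:
  assumes "i < n" "length ss = 5" "\<forall>s\<in>set ss. s < 3 + n"
  shows "case instr_trans c i ss of (q, acts) \<Rightarrow>
    q < 7 + n \<and> length acts = 5 \<and> symbols_below (3 + n) acts"
  using assms
  by (cases c)
    (auto simp: instr_trans_def letter_less_3 intro!: symbols_below_update symbols_below_idle)

lemma trans_compile_bounded:
  assumes "length ss = 5" "\<forall>s\<in>set ss. s < 3 + length cs"
  shows "case trans (compile cs) q ss of (q', acts) \<Rightarrow>
    q' < 7 + length cs \<and> length acts = 5 \<and> symbols_below (3 + length cs) acts"
proof -
  have "ss ! 4 < 3 + length cs"
    using assms by simp
  then show ?thesis
    using assms instr_trans_bounded[of "q - 4" "length cs" ss]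
    by (auto simp: compile_def intro!: symbols_below_update symbols_below_idle)
qed

lemma wf_machine_compile: "wf_machine (compile cs)"
  using trans_compile_bounded
  unfolding wf_machine_def compile_sizes symbols_below_def by (simp add: case_prod_beta) blast

definition tape_on :: "str \<Rightarrow> int \<Rightarrow> tape" where
  "tape_on w h = (h, snd (string_tape w))"

abbreviation tape_end :: "str \<Rightarrow> tape" where
  "tape_end w \<equiv> tape_on w (int (length w))"

lemma letter_neq_0 [simp]: "letter b \<noteq> 0"
  by (simp add: letter_def)

lemma letter_eq_iff [simp]: "letter b = letter c \<longleftrightarrow> b = c"
  by (simp add: letter_def)

lemma snd_string_tape:
  "snd (string_tape w) i = (if 0 \<le> i \<and> nat i < length w then letter (w ! nat i) else 0)"
  by (simp add: string_tape_def symbols_tape_def)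

lemma string_tape_eq: "string_tape w = tape_on w 0"
  by (simp add: tape_on_def string_tape_def symbols_tape_def)

lemma blank_tape_eq: "blank_tape = tape_on [] 0"
  by (simp add: blank_tape_def tape_on_def string_tape_def symbols_tape_def)

lemma tape_string_tape_on [simp]: "tape_string (tape_on w h) = w"
proof -
  have "(LEAST n. snd (tape_on w h) (int n) \<notin> range letter) = length w"
  proof (rule Least_equality)
    show "snd (tape_on w h) (int (length w)) \<notin> range letter"
      by (auto simp: tape_on_def snd_string_tape dest: sym)
  next
    fix n assume "snd (tape_on w h) (int n) \<notin> range letter"
    then show "length w \<le> n"
      by (cases "n < length w") (auto simp: tape_on_def snd_string_tape)
  qed
  then show ?thesis
    by (auto simp: tape_string_def tape_on_def snd_string_tape intro!: nth_equalityI)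
qed

fun displacement :: "head_move \<Rightarrow> int" where
  "displacement Move_Left = - 1"
| "displacement Stay = 0"
| "displacement Move_Right = 1"

lemma displacement_reverse_move [simp]: "displacement (reverse_move d) = - displacement d"
  by (cases d) simp_all

lemma tape_act_eq: "tape_act (s, m) (h, c) = (h + displacement m, c(h := s))"
  by (cases m) (simp_all add: tape_act.simps)

lemma tape_act_append: "tape_act (letter b, Move_Right) (tape_end w) = tape_end (w @ [b])"
  by (auto simp: tape_act_eq tape_on_def fun_eq_iff snd_string_tape nth_append)

lemma map2_tape_act_idle: "map2 tape_act (idle (map tape_read ts)) ts = ts"
proof (rule nth_equalityI)
  fix i assume "i < length (map2 tape_act (idle (map tape_read ts)) ts)"
  moreover have "tape_act (tape_read t, Stay) t = t" for t :: tape
    by (cases t) (simp add: tape_act_eq tape_read_def)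
  ultimately show "map2 tape_act (idle (map tape_read ts)) ts ! i = ts ! i"
    by (simp add: idle_def)
qed simp

lemma map2_tape_act_update:
  assumes "length acts = length ts" "s < length ts"
  shows "map2 tape_act (acts[s := x]) ts = (map2 tape_act acts ts)[s := tape_act x (ts ! s)]"
  using assms by (auto intro!: nth_equalityI simp: nth_list_update)

definition reaches :: "machine \<Rightarrow> strfun \<Rightarrow> nat \<Rightarrow> config \<Rightarrow> config \<Rightarrow> bool" where
  "reaches M \<phi> t c c' \<longleftrightarrow> (step M \<phi> ^^ t) c = c'"

lemma reaches_0: "reaches M \<phi> 0 c c"
  by (simp add: reaches_def)

lemma reaches_step: "step M \<phi> c = c' \<Longrightarrow> reaches M \<phi> 1 c c'"
  by (simp add: reaches_def)

lemma reaches_trans: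
  assumes "reaches M \<phi> t c c'" "reaches M \<phi> u c' c''"
  shows "reaches M \<phi> (t + u) c c''"
  using assms by (simp add: reaches_def funpow_add add.commute[of t u])

lemma step_instr:
  assumes "i < length cs"
  shows "step (compile cs) \<phi> (4 + i, ts) =
    (case instr_trans (cs ! i) i (map tape_read ts) of (q, acts) \<Rightarrow> (q, map2 tape_act acts ts))"
  using assms by (simp add: step.simps compile_def)

definition runs :: "strfun \<Rightarrow> instr list \<Rightarrow> nat \<Rightarrow> tape list \<Rightarrow> tape list \<Rightarrow> bool" where
  "runs \<phi> cs n ts ts' \<longleftrightarrow> (\<forall>as bs. reaches (compile (as @ cs @ bs)) \<phi> n
     (4 + length as, ts) (4 + length as + length cs, ts'))"

lemma runs_Nil: "runs \<phi> [] 0 ts ts"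
  by (simp add: runs_def reaches_0)

lemma runs_append:
  assumes "runs \<phi> cs n ts ts'" "runs \<phi> ds m ts' ts''"
  shows "runs \<phi> (cs @ ds) (n + m) ts ts''"
  unfolding runs_def
proof (intro allI)
  fix as bs
  have "reaches (compile (as @ cs @ ds @ bs)) \<phi> n
      (4 + length as, ts) (4 + length as + length cs, ts')"
    using assms(1) by (simp add: runs_def)
  moreover have "reaches (compile ((as @ cs) @ ds @ bs)) \<phi> m
      (4 + length (as @ cs), ts') (4 + length (as @ cs) + length ds, ts'')"
    using assms(2) unfolding runs_def by blast
  ultimately show "reaches (compile (as @ (cs @ ds) @ bs)) \<phi> (n + m) (4 + length as, ts)
      (4 + length as + length (cs @ ds), ts'')"
    by (simp add: reaches_trans add.assoc)
qed

lemma runs_single: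
  assumes "\<And>cs i. i < length cs \<Longrightarrow> cs ! i = c \<Longrightarrow> reaches (compile cs) \<phi> n (4 + i, ts) (5 + i, ts')"
  shows "runs \<phi> [c] n ts ts'"
  unfolding runs_def
proof (intro allI)
  fix as bs
  show "reaches (compile (as @ [c] @ bs)) \<phi> n (4 + length as, ts) (4 + length as + length [c], ts')"
    using assms[of "length as" "as @ [c] @ bs"] by simp
qed

lemma runs_concat_replicate:
  assumes "\<And>j. runs \<phi> cs n (T j) (T (Suc j))"
  shows "runs \<phi> (concat (replicate k cs)) (k * n) (T 0) (T k)"
proof (induction k)
  case 0
  show ?case by (simp add: runs_Nil)
next
  case (Suc k)
  have "concat (replicate (Suc k) cs) = concat (replicate k cs) @ cs"
    by (induction k) simp_all
  then show ?case
    using runs_append[OF Suc.IH assms[of k]] by (simp add: add.commute)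
qed

lemma runs_Put:
  assumes "t < length ts" "ts ! t = tape_end w"
  shows "runs \<phi> [Put t b] 1 ts (ts[t := tape_end (w @ [b])])"
  using assms
  by (intro runs_single reaches_step)
    (simp add: step_instr instr_trans_def map2_tape_act_update map2_tape_act_idle tape_act_append)

lemma runs_replicate_Put:
  assumes "t < length ts" "ts ! t = tape_end w"
  shows "runs \<phi> (replicate k (Put t b)) k ts (ts[t := tape_end (w @ replicate k b)])"
proof -
  have "runs \<phi> [Put t b] 1 (ts[t := tape_end (w @ replicate j b)])
      (ts[t := tape_end (w @ replicate (Suc j) b)])" for j
    using runs_Put[of t "ts[t := tape_end (w @ replicate j b)]" "w @ replicate j b" \<phi> b] assms(1)
    by (simp add: replicate_append_same)
  from runs_concat_replicate[of \<phi> _ 1 "\<lambda>j. ts[t := tape_end (w @ replicate j b)]", OF this]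
  show ?thesis
    using assms(2) list_update_id[of ts t] by (simp add: concat_replicate_single)
qed

lemma step_Scan_letter:
  assumes "i < length cs" "cs ! i = Scan d s t f" "s \<noteq> t" "s < length ts" "t < length ts"
    and "ts ! s = (h, c)" "c h = letter x" "ts ! t = tape_end v"
  shows "step (compile cs) \<phi> (4 + i, ts) =
    (4 + i, ts[s := (h + displacement d, c), t := tape_end (v @ [f x])])"
  using assms
  by (simp add: step_instr instr_trans_def map2_tape_act_update map2_tape_act_idle tape_act_append
      tape_read_def tape_act_eq[of _ _ h c] fun_upd_idem)

lemma step_Scan_blank:
  assumes "i < length cs" "cs ! i = Scan d s t f" "s < length ts"
    and "ts ! s = (h, c)" "c h = 0"
  shows "step (compile cs) \<phi> (4 + i, ts) = (5 + i, ts[s := (h - displacement d, c)])"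
  using assms
  by (simp add: step_instr instr_trans_def map2_tape_act_update map2_tape_act_idle
      tape_read_def tape_act_eq fun_upd_idem)

lemma reaches_Scan:
  assumes "i < length cs" "cs ! i = Scan d s t f" "s \<noteq> t" "s < length ts" "t < length ts"
    and "ts ! s = (h, c)" "ts ! t = tape_end v"
    and "\<And>k. k < length xs \<Longrightarrow> c (h + int k * displacement d) = letter (xs ! k)"
    and "c (h + int (length xs) * displacement d) = 0"
  shows "reaches (compile cs) \<phi> (length xs + 1) (4 + i, ts)
    (5 + i, ts[s := (h + (int (length xs) - 1) * displacement d, c), t := tape_end (v @ map f xs)])"
  using assms(4-)
proof (induction xs arbitrary: h v ts)
  case Nil
  then have "ts[t := tape_end v] = ts" by (metis list_update_id)
  then show ?case
    using Nil assms(1-3) list_update_swap[OF assms(3), of ts]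
    by (simp add: reaches_step[unfolded One_nat_def] step_Scan_blank)
next
  case (Cons x xs)
  let ?\<delta> = "displacement d"
  define ts' where "ts' = ts[s := (h + ?\<delta>, c), t := tape_end (v @ [f x])]"
  have "reaches (compile cs) \<phi> 1 (4 + i, ts) (4 + i, ts')"
    unfolding ts'_def using Cons.prems Cons.prems(5)[of 0] assms(1-3)
    by (intro reaches_step step_Scan_letter) simp_all
  moreover have "reaches (compile cs) \<phi> (length xs + 1) (4 + i, ts')
    (5 + i, ts'[s := (h + ?\<delta> + (int (length xs) - 1) * ?\<delta>, c),
                t := tape_end ((v @ [f x]) @ map f xs)])"
  proof (rule Cons.IH)
    show "c (h + ?\<delta> + int k * ?\<delta>) = letter (xs ! k)" if "k < length xs" for k
      using Cons.prems(5)[of "Suc k"] that by (simp add: algebra_simps)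
    show "c (h + ?\<delta> + int (length xs) * ?\<delta>) = 0"
      using Cons.prems(6) by (simp add: algebra_simps)
  qed (use Cons.prems assms(3) in \<open>simp_all add: ts'_def\<close>)
  moreover have "ts'[s := y, t := z] = ts[s := y, t := z]" for y z
    using assms(3) by (simp add: ts'_def list_update_swap)
  moreover have "h + ?\<delta> + (int (length xs) - 1) * ?\<delta> = h + (int (length (x # xs)) - 1) * ?\<delta>"
    by (simp add: algebra_simps)
  ultimately show ?case
    using reaches_trans[of "compile cs" \<phi> 1 _ "(4 + i, ts')"] by simp
qed

lemma runs_Scan_right:
  assumes "s \<noteq> t" "s < length ts" "t < length ts" "ts ! s = tape_on w 0" "ts ! t = tape_end v"
  shows "runs \<phi> [Scan Move_Right s t f] (length w + 1) ts
    (ts[s := tape_on w (int (length w) - 1), t := tape_end (v @ map f w)])"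
  using reaches_Scan[of _ _ Move_Right s t f ts 0 "snd (string_tape w)" v w] assms
  by (intro runs_single) (simp add: tape_on_def snd_string_tape)

lemma runs_Scan_left:
  assumes "s \<noteq> t" "s < length ts" "t < length ts"
    and "ts ! s = tape_on w (int (length w) - 1)" "ts ! t = tape_end v"
  shows "runs \<phi> [Scan Move_Left s t f] (length w + 1) ts
    (ts[s := tape_on w 0, t := tape_end (v @ map f (rev w))])"
proof (rule runs_single)
  have "snd (string_tape w) (int (length w) - 1 - int k) = letter (rev w ! k)"
    if "k < length w" for k
    using that by (simp add: snd_string_tape rev_nth nat_diff_distrib flip: of_nat_Suc of_nat_diff)
  then show "reaches (compile cs) \<phi> (length w + 1) (4 + i, ts)
      (5 + i, ts[s := tape_on w 0, t := tape_end (v @ map f (rev w))])"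
    if "i < length cs" "cs ! i = Scan Move_Left s t f" for cs i
    using assms
      reaches_Scan[OF that assms(1-3), of "int (length w) - 1" "snd (string_tape w)" v "rev w"]
    by (simp add: tape_on_def snd_string_tape)
qed

definition sweep :: "nat \<Rightarrow> nat \<Rightarrow> instr list" where
  "sweep s t = [Scan Move_Right s t (\<lambda>_. False), Scan Move_Left s t (\<lambda>_. False)]"

lemma runs_sweep:
  assumes "s \<noteq> t" "s < length ts" "t < length ts" "ts ! s = tape_on w 0" "ts ! t = tape_end v"
  shows "runs \<phi> (sweep s t) (2 * (length w + 1)) ts
    (ts[t := tape_end (v @ replicate (2 * length w) False)])"
proof -
  let ?z = "replicate (length w) False"
  let ?ts = "ts[s := tape_on w (int (length w) - 1), t := tape_end (v @ ?z)]"
  have zeros: "map (\<lambda>_. False) u = replicate (length u) False" for u :: str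
    by (simp add: map_replicate_const)
  have rightwards: "runs \<phi> [Scan Move_Right s t (\<lambda>_. False)] (length w + 1) ts ?ts"
    using runs_Scan_right[OF assms, of \<phi> "\<lambda>_. False"] by (simp only: zeros)
  have "runs \<phi> [Scan Move_Left s t (\<lambda>_. False)] (length w + 1) ?ts
      (?ts[s := tape_on w 0, t := tape_end ((v @ ?z) @ map (\<lambda>_. False) (rev w))])"
    using assms by (intro runs_Scan_left) simp_all
  moreover have "?ts[s := tape_on w 0, t := y] = ts[t := y]" for y
    using assms by (intro nth_equalityI) (auto simp: nth_list_update)
  moreover have "(v @ ?z) @ map (\<lambda>_. False) (rev w) = v @ replicate (2 * length w) False"
    by (simp add: zeros mult_2 replicate_add)
  ultimately have "runs \<phi> [Scan Move_Left s t (\<lambda>_. False)] (length w + 1) ?ts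
      (ts[t := tape_end (v @ replicate (2 * length w) False)])"
    by (simp only:)
  from runs_append[OF rightwards this] show ?thesis
    by (simp add: sweep_def flip: mult_2)
qed

lemma runs_sweeps:
  assumes "s \<noteq> t" "s < length ts" "t < length ts" "ts ! s = tape_on w 0" "ts ! t = tape_end v"
  shows "runs \<phi> (concat (replicate k (sweep s t))) (k * (2 * (length w + 1))) ts
    (ts[t := tape_end (v @ replicate (2 * k * length w) False)])"
proof -
  define T where "T j = ts[t := tape_end (v @ replicate (2 * j * length w) False)]" for j
  have "runs \<phi> (sweep s t) (2 * (length w + 1)) (T j) (T (Suc j))" for j
    using runs_sweep[of s t "T j" w "v @ replicate (2 * j * length w) False" \<phi>] assms
    by (simp add: T_def replicate_add[symmetric] algebra_simps)
  from runs_concat_replicate[of \<phi> "sweep s t" _ T, OF this] show ?thesis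
    using assms(5) list_update_id[of ts t] by (simp add: T_def)
qed

lemma runs_Query:
  "runs \<phi> [Query] 3 [a, b, tape_on w h, d, blank_tape]
    [a, b, blank_tape, string_tape (\<phi> w), blank_tape]"
proof (rule runs_single)
  fix cs and i :: nat
  assume i: "i < length cs" "cs ! i = Query"
  let ?M = "compile cs" and ?return = "(0, (\<lambda>_. 0)(0 := Suc i)) :: tape"
  have "step ?M \<phi> (4 + i, [a, b, tape_on w h, d, blank_tape])
      = (2, [a, b, tape_on w h, d, ?return])"
    unfolding step_instr[OF i(1)] i instr_trans_def
    by (simp add: map2_tape_act_update map2_tape_act_idle tape_act_eq blank_tape_def del: list.map)
  moreover have "step ?M \<phi> (2, [a, b, tape_on w h, d, ?return])
      = (3, [a, b, blank_tape, string_tape (\<phi> w), ?return])"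
    by (simp add: step.simps eval_nat_numeral)
  moreover have "step ?M \<phi> (3, ts) = (4 + tape_read (ts ! 4), ts[4 := tape_act (0, Stay) (ts ! 4)])"
    if "length ts = 5" for ts
    using that by (simp add: step.simps compile_def map2_tape_act_update map2_tape_act_idle)
  from this[of "[a, b, blank_tape, string_tape (\<phi> w), ?return]"]
  have "step ?M \<phi> (3, [a, b, blank_tape, string_tape (\<phi> w), ?return])
      = (5 + i, [a, b, blank_tape, string_tape (\<phi> w), blank_tape])"
    by (simp add: tape_act_eq tape_read_def blank_tape_def fun_upd_idem)
  ultimately show "reaches ?M \<phi> 3 (4 + i, [a, b, tape_on w h, d, blank_tape])
      (5 + i, [a, b, blank_tape, string_tape (\<phi> w), blank_tape])"
    by (simp add: reaches_def numeral_3_eq_3)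
qed

lemma computes_within_compile:
  assumes "runs \<phi> cs n [string_tape a, blank_tape, blank_tape, blank_tape, blank_tape] ts"
    and "ts ! 1 = tape_end b"
  shows "computes_within (compile cs) \<phi> [a] b (n + 2)"
proof -
  let ?M = "compile cs"
  let ?start = "[string_tape a, blank_tape, blank_tape, blank_tape, blank_tape]"
  have init: "init_config ?M [a] = (0, ?start)"
    by (simp add: init_config_def compile_def string_tape_def eval_nat_numeral)
  have "reaches ?M \<phi> 1 (0, ?start) (4, ?start)"
    by (rule reaches_step) (simp add: step.simps compile_def map2_tape_act_idle del: list.map)
  moreover have "reaches ?M \<phi> n (4, ?start) (4 + length cs, ts)"
    using assms(1)[unfolded runs_def, rule_format, of "[]" "[]"] by simp
  moreover have "reaches ?M \<phi> 1 (4 + length cs, ts) (1, ts)"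
    by (rule reaches_step) (simp add: step.simps compile_def map2_tape_act_idle)
  ultimately have "reaches ?M \<phi> (1 + n + 1) (0, ?start) (1, ts)"
    by (blast intro: reaches_trans)
  then show ?thesis
    using assms(2) unfolding computes_within_def reaches_def init
    by (intro exI[of _ "n + 2"]) simp
qed

section \<open>The padding machine\<close>

lemma length_eq_fun_size:
  assumes "length_monotone \<phi>"
  shows "length (\<phi> w) = fun_size \<phi> (length w)"
  using assms unfolding length_monotone_def fun_size_def ones_def
  by (metis dual_order.refl length_replicate order_antisym)

lemma fun_size_mono:
  assumes "length_monotone \<phi>"
  shows "mono (fun_size \<phi>)"
  using assms by (simp add: mono_def length_monotone_def fun_size_def ones_def)

definition pad_length :: "nat \<Rightarrow> nat \<Rightarrow> (nat \<Rightarrow> nat) \<Rightarrow> nat \<Rightarrow> nat" where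
  "pad_length k m l n = m + 2 * k * n + 2 * k * l (n + m)"

definition padded :: "nat \<Rightarrow> nat \<Rightarrow> strfun \<Rightarrow> strfun" where
  "padded k m \<phi> a = \<phi> a @ replicate (pad_length k m (fun_size \<phi>) (length a)) False"

definition pad_time :: "nat \<Rightarrow> nat \<Rightarrow> (nat \<Rightarrow> nat) \<Rightarrow> nat \<Rightarrow> nat" where
  "pad_time k m l n = 4 * k + 2 * m + 11 + (2 * k + 2) * n + l n + 2 * k * l (n + m)"

lemma mono_pad_length:
  assumes "mono l"
  shows "mono (pad_length k m l)"
  unfolding pad_length_def by (intro monoI add_mono mult_le_mono monoD[OF assms]) simp_all

lemma fun_size_padded: "fun_size (padded k m \<phi>) n = fun_size \<phi> n + pad_length k m (fun_size \<phi>) n"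
  by (simp add: fun_size_def[of "padded k m \<phi>"] fun_size_def[of \<phi> n] padded_def ones_def)

lemma length_monotone_padded:
  assumes "length_monotone \<phi>"
  shows "length_monotone (padded k m \<phi>)"
  unfolding length_monotone_def
proof (intro allI impI)
  fix a b :: str assume "length a \<le> length b"
  then show "length (padded k m \<phi> a) \<le> length (padded k m \<phi> b)"
    using assms monoD[OF mono_pad_length[OF fun_size_mono[OF assms]]]
    unfolding padded_def by (simp add: add_mono length_monotone_def)
qed

abbreviation (input) input_tape :: nat where "input_tape \<equiv> 0"
abbreviation (input) output_tape :: nat where "output_tape \<equiv> 1"
abbreviation (input) query_tape :: nat where "query_tape \<equiv> 2"
abbreviation (input) answer_tape :: nat where "answer_tape \<equiv> 3"

definition copy_answer :: "instr list" where
  "copy_answer = [Scan Move_Right input_tape query_tape id] @ [Query] @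
     [Scan Move_Right answer_tape output_tape id]"

text \<open>Only the length of the answer to this query matters.\<close>

definition query_longer :: "nat \<Rightarrow> instr list" where
  "query_longer m = [Scan Move_Left input_tape query_tape id] @
     replicate m (Put query_tape False) @ [Query]"

definition pad_output :: "nat \<Rightarrow> nat \<Rightarrow> instr list" where
  "pad_output k m = replicate m (Put output_tape False) @
     concat (replicate k (sweep input_tape output_tape)) @
     concat (replicate k (sweep answer_tape output_tape))"

definition pad_program :: "nat \<Rightarrow> nat \<Rightarrow> instr list" where
  "pad_program k m = copy_answer @ query_longer m @ pad_output k m"

lemma runs_copy_answer:
  "runs \<phi> copy_answer (length a + length (\<phi> a) + 5)
    [tape_on a 0, blank_tape, blank_tape, d, blank_tape]
    [tape_on a (int (length a) - 1), tape_end (\<phi> a), blank_tape,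
      tape_on (\<phi> a) (int (length (\<phi> a)) - 1), blank_tape]"
proof -
  let ?B = blank_tape
  let ?in = "tape_on a (int (length a) - 1)"
  have "runs \<phi> [Scan Move_Right input_tape query_tape id] (length a + 1)
      [tape_on a 0, ?B, ?B, d, ?B] [?in, ?B, tape_end a, d, ?B]"
    using runs_Scan_right[of input_tape query_tape "[tape_on a 0, ?B, ?B, d, ?B]" a "[]" \<phi> id]
    by (simp add: blank_tape_eq eval_nat_numeral)
  moreover have "runs \<phi> [Query] 3 [?in, ?B, tape_end a, d, ?B] [?in, ?B, ?B, tape_on (\<phi> a) 0, ?B]"
    using runs_Query by (simp add: string_tape_eq)
  moreover have "runs \<phi> [Scan Move_Right answer_tape output_tape id] (length (\<phi> a) + 1)
      [?in, ?B, ?B, tape_on (\<phi> a) 0, ?B]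
      [?in, tape_end (\<phi> a), ?B, tape_on (\<phi> a) (int (length (\<phi> a)) - 1), ?B]"
    using runs_Scan_right[of answer_tape output_tape "[?in, ?B, ?B, tape_on (\<phi> a) 0, ?B]"
        "\<phi> a" "[]" \<phi> id]
    by (simp add: blank_tape_eq eval_nat_numeral)
  ultimately have "runs \<phi> copy_answer (length a + 1 + (3 + (length (\<phi> a) + 1)))
      [tape_on a 0, ?B, ?B, d, ?B]
      [?in, tape_end (\<phi> a), ?B, tape_on (\<phi> a) (int (length (\<phi> a)) - 1), ?B]"
    unfolding copy_answer_def by (intro runs_append)
  then show ?thesis
    by (simp add: algebra_simps)
qed

lemma runs_query_longer:
  "runs \<phi> (query_longer m) (length a + m + 4)
    [tape_on a (int (length a) - 1), v, blank_tape, d, blank_tape]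
    [tape_on a 0, v, blank_tape, tape_on (\<phi> (rev a @ replicate m False)) 0, blank_tape]"
proof -
  let ?B = blank_tape
  let ?w = "rev a @ replicate m False"
  have "runs \<phi> [Scan Move_Left input_tape query_tape id] (length a + 1)
      [tape_on a (int (length a) - 1), v, ?B, d, ?B] [tape_on a 0, v, tape_end (rev a), d, ?B]"
    using runs_Scan_left[of input_tape query_tape "[tape_on a (int (length a) - 1), v, ?B, d, ?B]"
        a "[]" \<phi> id]
    by (simp add: blank_tape_eq eval_nat_numeral)
  moreover have "runs \<phi> (replicate m (Put query_tape False)) m
      [tape_on a 0, v, tape_end (rev a), d, ?B] [tape_on a 0, v, tape_end ?w, d, ?B]"
    using runs_replicate_Put[of query_tape "[tape_on a 0, v, tape_end (rev a), d, ?B]"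
        "rev a" \<phi> m False]
    by (simp add: eval_nat_numeral)
  moreover have "runs \<phi> [Query] 3
      [tape_on a 0, v, tape_end ?w, d, ?B] [tape_on a 0, v, ?B, tape_on (\<phi> ?w) 0, ?B]"
    using runs_Query by (simp add: string_tape_eq)
  ultimately have "runs \<phi> (query_longer m) (length a + 1 + (m + 3))
      [tape_on a (int (length a) - 1), v, ?B, d, ?B] [tape_on a 0, v, ?B, tape_on (\<phi> ?w) 0, ?B]"
    unfolding query_longer_def by (intro runs_append)
  then show ?thesis
    by (simp add: algebra_simps)
qed

lemma runs_pad_output:
  "runs \<phi> (pad_output k m) (m + k * (2 * (length a + 1)) + k * (2 * (length w + 1)))
    [tape_on a 0, tape_end v, q, tape_on w 0, r]
    [tape_on a 0, tape_end (v @ replicate (m + 2 * k * length a + 2 * k * length w) False), q,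
      tape_on w 0, r]"
proof -
  let ?ts = "\<lambda>n. [tape_on a 0, tape_end (v @ replicate n False), q, tape_on w 0, r]"
  have "runs \<phi> (replicate m (Put output_tape False)) m (?ts 0) (?ts m)"
    using runs_replicate_Put[of output_tape "?ts 0" v \<phi> m False] by simp
  moreover have "runs \<phi> (concat (replicate k (sweep input_tape output_tape)))
      (k * (2 * (length a + 1))) (?ts m) (?ts (m + 2 * k * length a))"
    using runs_sweeps[of input_tape output_tape "?ts m" a "v @ replicate m False" \<phi> k]
    by (simp add: replicate_add add.assoc)
  moreover have "runs \<phi> (concat (replicate k (sweep answer_tape output_tape)))
      (k * (2 * (length w + 1))) (?ts (m + 2 * k * length a))
      (?ts (m + 2 * k * length a + 2 * k * length w))"
    using runs_sweeps[of answer_tape output_tape "?ts (m + 2 * k * length a)" w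
        "v @ replicate (m + 2 * k * length a) False" \<phi> k]
    by (simp add: replicate_add add.assoc eval_nat_numeral)
  ultimately have "runs \<phi> (pad_output k m)
      (m + (k * (2 * (length a + 1)) + k * (2 * (length w + 1))))
      (?ts 0) (?ts (m + 2 * k * length a + 2 * k * length w))"
    unfolding pad_output_def by (intro runs_append)
  then show ?thesis
    by (simp add: add.assoc)
qed

lemma pad_program_computes_padded:
  assumes "length_monotone \<phi>"
  shows "computes_within (compile (pad_program k m)) \<phi> [a] (padded k m \<phi> a)
    (pad_time k m (fun_size \<phi>) (length a))"
proof -
  let ?w = "rev a @ replicate m False"
  let ?t = "length a + length (\<phi> a) + 5 + (length a + m + 4 +
    (m + k * (2 * (length a + 1)) + k * (2 * (length (\<phi> ?w) + 1))))"
  have pad: "m + 2 * k * length a + 2 * k * length (\<phi> ?w) = pad_length k m (fun_size \<phi>) (length a)"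
    using length_eq_fun_size[OF assms, of ?w] by (simp add: pad_length_def)
  have "runs \<phi> (pad_program k m) ?t
    [tape_on a 0, blank_tape, blank_tape, blank_tape, blank_tape]
    [tape_on a 0, tape_end (\<phi> a @ replicate (m + 2 * k * length a + 2 * k * length (\<phi> ?w)) False),
      blank_tape, tape_on (\<phi> ?w) 0, blank_tape]"
    unfolding pad_program_def
    by (intro runs_append[OF runs_copy_answer] runs_append[OF runs_query_longer] runs_pad_output)
  then have "computes_within (compile (pad_program k m)) \<phi> [a] (padded k m \<phi> a) (?t + 2)"
    unfolding pad padded_def[symmetric] string_tape_eq[symmetric]
    by (rule computes_within_compile) simp
  moreover have "?t + 2 = pad_time k m (fun_size \<phi>) (length a)"
    using length_eq_fun_size[OF assms, of ?w] length_eq_fun_size[OF assms, of a]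
    by (simp add: pad_time_def algebra_simps)
  ultimately show ?thesis by simp
qed

lemma second_order_poly_const: "second_order_poly (\<lambda>l n. c)"
  using second_order_poly.base[of "[:int c:]"] by simp

lemma second_order_poly_arg: "second_order_poly (\<lambda>l n. n)"
  using second_order_poly.base[of "[:0, 1:]"] by simp

lemma second_order_poly_pad_time: "second_order_poly (pad_time k m)"
  unfolding pad_time_def[abs_def]
  by (intro second_order_poly.add second_order_poly.mult second_order_poly.app
      second_order_poly_const second_order_poly_arg)

section \<open>Dyadic codes\<close>

definition binary_fraction :: "str \<Rightarrow> real" where
  "binary_fraction d = (\<Sum>i<length d. of_bool (d ! i) / 2 ^ Suc i)"

lemma dyadic_Cons:
  "dyadic (s # w) = (let k = length (takeWhile id w) in
     (if s then - 1 else 1) * 2 ^ k * binary_fraction (drop (Suc k) w))"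
  by (simp add: binary_fraction_def Let_def)

lemma binary_fraction_append_zeros: "binary_fraction (d @ replicate k False) = binary_fraction d"
  unfolding binary_fraction_def
  by (rule sum.mono_neutral_cong_right) (auto simp: nth_append)

lemma binary_fraction_nonneg: "0 \<le> binary_fraction d"
  by (simp add: binary_fraction_def sum_nonneg)

lemma binary_fraction_le_1: "binary_fraction d \<le> 1"
proof -
  have "binary_fraction d \<le> (\<Sum>i<length d. (1 / 2) ^ Suc i)"
    unfolding binary_fraction_def by (intro sum_mono) (auto simp: power_divide)
  also have "\<dots> = 1 - (1 / 2) ^ length d"
    using sum_gp_strict[of "1 / 2 :: real" "length d"]
    by (simp only: power_Suc sum_distrib_left[symmetric]) simp
  finally show ?thesis
    by (simp add: order_trans)
qed

lemma length_takeWhile_append_zeros: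
  "length (takeWhile id (w @ replicate k False)) = length (takeWhile id w)"
  by (induction w) (cases k; simp)+

lemma dyadic_append_zeros: "dyadic (w @ replicate k False) = dyadic w"
proof (cases w)
  case Nil
  have "binary_fraction (replicate j False) = 0" for j
    by (simp add: binary_fraction_def)
  then show ?thesis
    by (cases k) (simp_all add: Nil dyadic_Cons Let_def del: dyadic.simps(2))
next
  case (Cons s v)
  let ?i = "length (takeWhile id v)"
  have "drop (Suc ?i) (v @ replicate k False)
      = drop (Suc ?i) v @ replicate (k - (Suc ?i - length v)) False"
    by simp
  then show ?thesis
    by (simp add: Cons dyadic_Cons Let_def length_takeWhile_append_zeros
        binary_fraction_append_zeros del: dyadic.simps(2) drop_append)
qed

lemma abs_dyadic_le: "\<bar>dyadic w\<bar> \<le> 2 ^ length w"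
proof (cases w)
  case (Cons s v)
  let ?i = "length (takeWhile id v)"
  have "\<bar>dyadic w\<bar> = 2 ^ ?i * binary_fraction (drop (Suc ?i) v)"
    by (simp add: Cons dyadic_Cons Let_def abs_mult binary_fraction_nonneg del: dyadic.simps(2))
  also have "\<dots> \<le> 2 ^ ?i * 1"
    by (intro mult_left_mono binary_fraction_le_1) simp
  also have "\<dots> \<le> 2 ^ length w"
    using length_takeWhile_le[of id v] power_increasing[of ?i "length w" "2::real"]
    by (simp add: Cons)
  finally show ?thesis .
qed simp

lemma dyadic_padded: "dyadic (padded k m \<phi> a) = dyadic (\<phi> a)"
  by (simp add: padded_def dyadic_append_zeros)

section \<open>Functions orthogonal to polynomials\<close>

lemma integrable_mult_continuous:
  fixes v q :: "'a::euclidean_space \<Rightarrow> real"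
  assumes v: "integrable (lebesgue_on S) v" and q: "continuous_on S q" and S: "compact S"
  shows "integrable (lebesgue_on S) (\<lambda>x. v x * q x)"
proof -
  have S_sets: "S \<in> sets lebesgue"
    using S by (simp add: compact_imp_closed)
  obtain C where C: "\<And>x. x \<in> S \<Longrightarrow> \<bar>q x\<bar> \<le> C"
    using compact_imp_bounded[OF compact_continuous_image[OF q S]] unfolding bounded_iff by auto
  show ?thesis
  proof (rule Bochner_Integration.integrable_bound)
    show "integrable (lebesgue_on S) (\<lambda>x. C * v x)"
      using v by simp
    show "(\<lambda>x. v x * q x) \<in> borel_measurable (lebesgue_on S)"
      using v continuous_imp_measurable_on_sets_lebesgue[OF q S_sets]
      by (intro borel_measurable_times) auto
    show "AE x in lebesgue_on S. norm (v x * q x) \<le> norm (C * v x)"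
    proof (rule AE_I2)
      fix x assume "x \<in> space (lebesgue_on S)"
      then have "\<bar>q x\<bar> \<le> \<bar>C\<bar>"
        using C[of x] by simp
      then show "norm (v x * q x) \<le> norm (C * v x)"
        by (simp add: abs_mult mult.commute mult_right_mono)
    qed
  qed
qed

lemma Weierstrass_poly:
  fixes f :: "real \<Rightarrow> real"
  assumes "continuous_on {a..b} f" "0 < e"
  obtains P where "\<And>x. x \<in> {a..b} \<Longrightarrow> \<bar>f x - poly P x\<bar> < e"
proof -
  obtain q where q: "real_polynomial_function q" "\<And>x. x \<in> {a..b} \<Longrightarrow> \<bar>f x - q x\<bar> < e"
    using Stone_Weierstrass_real_polynomial_function[OF compact_Icc assms] by blast
  obtain c n where "q = (\<lambda>x. \<Sum>i\<le>n. c i * x ^ i)"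
    using q(1) unfolding real_polynomial_function_iff_sum by auto
  then have "q = poly (\<Sum>i\<le>n. monom (c i) i)"
    by (simp add: fun_eq_iff poly_sum poly_monom)
  then show ?thesis
    using q(2) that by blast
qed

lemma orthogonal_continuous_if_orthogonal_polynomials:
  fixes v f :: "real \<Rightarrow> real"
  assumes v: "integrable (lebesgue_on {a..b}) v" and f: "continuous_on {a..b} f"
    and orth: "\<And>P. (LINT x|lebesgue_on {a..b}. v x * poly P x) = 0"
  shows "(LINT x|lebesgue_on {a..b}. v x * f x) = 0"
proof -
  let ?M = "lebesgue_on {a..b}"
  define J where "J = (LINT x|?M. \<bar>v x\<bar>)"
  have J: "0 \<le> J"
    unfolding J_def by (rule Bochner_Integration.integral_nonneg) simp
  have "\<bar>LINT x|?M. v x * f x\<bar> \<le> e" if e: "0 < e" for e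
  proof -
    obtain P where P: "\<And>x. x \<in> {a..b} \<Longrightarrow> \<bar>f x - poly P x\<bar> < e / (J + 1)"
      by (rule Weierstrass_poly[OF f, of "e / (J + 1)"]) (use e J in auto)
    have vf: "integrable ?M (\<lambda>x. v x * f x)" and vP: "integrable ?M (\<lambda>x. v x * poly P x)"
      using v f by (auto intro!: integrable_mult_continuous continuous_intros)
    have "(LINT x|?M. v x * f x) = (LINT x|?M. v x * f x - v x * poly P x)"
      using vf vP by (simp add: orth)
    also have "\<bar>\<dots>\<bar> \<le> (LINT x|?M. \<bar>v x * f x - v x * poly P x\<bar>)"
      using integral_norm_bound[of ?M "\<lambda>x. v x * f x - v x * poly P x"] by simp
    also have "\<dots> \<le> (LINT x|?M. e / (J + 1) * \<bar>v x\<bar>)"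
    proof (rule integral_mono)
      fix x assume "x \<in> space ?M"
      then have "\<bar>f x - poly P x\<bar> \<le> e / (J + 1)"
        using P[of x] by simp
      then have "\<bar>v x\<bar> * \<bar>f x - poly P x\<bar> \<le> \<bar>v x\<bar> * (e / (J + 1))"
        by (intro mult_left_mono) simp_all
      then show "\<bar>v x * f x - v x * poly P x\<bar> \<le> e / (J + 1) * \<bar>v x\<bar>"
        by (simp add: abs_mult[symmetric] right_diff_distrib mult.commute)
    qed (use v vf vP in auto)
    also have "\<dots> = e * (J / (J + 1))"
      by (simp add: J_def)
    also have "\<dots> \<le> e"
      using e J by (intro mult_left_le) auto
    finally show ?thesis .
  qed
  then show ?thesis
    using field_le_epsilon[of "\<bar>LINT x|?M. v x * f x\<bar>" 0] by simp
qed

lemma bounded_measurable_AE_limit_continuous: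
  fixes f :: "'a::euclidean_space \<Rightarrow> real"
  assumes f: "f \<in> borel_measurable lebesgue" and B: "\<And>x. \<bar>f x\<bar> \<le> B"
  obtains c where "\<And>n. continuous_on UNIV (c n)" "\<And>n x. \<bar>c n x\<bar> \<le> B"
    "AE x in lebesgue. (\<lambda>n. c n x) \<longlonglongrightarrow> f x"
proof -
  have "f measurable_on UNIV"
    using f by (intro lebesgue_measurable_imp_measurable_on) auto
  then obtain N g where N: "negligible N" and g: "\<And>n. continuous_on UNIV (g n :: 'a \<Rightarrow> real)"
    and lim: "\<And>x. x \<notin> N \<Longrightarrow> (\<lambda>n. g n x) \<longlonglongrightarrow> f x"
    unfolding measurable_on_def by auto
  define c where "c n x = max (- B) (min B (g n x))" for n x
  have clamp: "max (- B) (min B (f x)) = f x" for x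
    using B[of x] by (auto simp: abs_le_iff)
  have "AE x in lebesgue. x \<notin> N"
    using N by (intro AE_not_in) (simp add: negligible_iff_null_sets)
  then have "AE x in lebesgue. (\<lambda>n. c n x) \<longlonglongrightarrow> f x"
  proof eventually_elim
    case (elim x)
    have "(\<lambda>n. c n x) \<longlonglongrightarrow> max (- B) (min B (f x))"
      unfolding c_def by (intro tendsto_intros lim elim)
    then show ?case by (simp only: clamp)
  qed
  moreover have "continuous_on UNIV (c n)" for n
    unfolding c_def by (intro continuous_intros g)
  moreover have "\<bar>c n x\<bar> \<le> B" for n x
    using B[of x] by (auto simp: c_def)
  ultimately show ?thesis
    using that by blast
qed

lemma AE_zero_if_orthogonal_polynomials:
  fixes v :: "real \<Rightarrow> real"
  assumes v: "integrable (lebesgue_on {a..b}) v"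
    and orth: "\<And>P. (LINT x|lebesgue_on {a..b}. v x * poly P x) = 0"
  shows "AE x in lebesgue_on {a..b}. v x = 0"
proof -
  let ?M = "lebesgue_on {a..b}"
  let ?s = "\<lambda>x. sgn (if x \<in> {a..b} then v x else 0)"
  have "(\<lambda>x. if x \<in> {a..b} then v x else 0) \<in> borel_measurable lebesgue"
    using borel_measurable_integrable[OF v] by (rule borel_measurable_if_I) simp
  then have "?s \<in> borel_measurable lebesgue"
    by measurable
  then obtain c where c: "\<And>n. continuous_on UNIV (c n)" "\<And>n x. \<bar>c n x\<bar> \<le> 1"
      "AE x in lebesgue. (\<lambda>n. c n x) \<longlonglongrightarrow> ?s x"
    by (rule bounded_measurable_AE_limit_continuous[where B = 1]) (auto simp: abs_sgn_eq)
  have vc: "integrable ?M (\<lambda>x. v x * c n x)" for n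
    using v continuous_on_subset[OF c(1)] by (intro integrable_mult_continuous) auto
  have "AE x in ?M. (\<lambda>n. c n x) \<longlonglongrightarrow> ?s x"
    using c(3) by (auto simp: AE_restrict_space_iff elim!: eventually_mono)
  then have "AE x in ?M. (\<lambda>n. v x * c n x) \<longlonglongrightarrow> v x * ?s x"
    by eventually_elim (intro tendsto_intros)
  moreover have "AE x in ?M. v x * ?s x = \<bar>v x\<bar>"
    by (intro AE_I2) (simp add: abs_sgn)
  ultimately have "AE x in ?M. (\<lambda>n. v x * c n x) \<longlonglongrightarrow> \<bar>v x\<bar>"
    by eventually_elim simp
  moreover have "norm (v x * c n x) \<le> \<bar>v x\<bar>" for n x
    using c(2)[of n x] by (simp add: abs_mult mult_left_le)
  ultimately have "(\<lambda>n. LINT x|?M. v x * c n x) \<longlonglongrightarrow> (LINT x|?M. \<bar>v x\<bar>)"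
    using v vc by (intro integral_dominated_convergence[where w = "\<lambda>x. \<bar>v x\<bar>"]) auto
  moreover have "(LINT x|?M. v x * c n x) = 0" for n
    by (rule orthogonal_continuous_if_orthogonal_polynomials[OF v _ orth])
      (rule continuous_on_subset[OF c(1)], simp)
  ultimately have "(LINT x|?M. \<bar>v x\<bar>) = 0"
    by (simp add: LIMSEQ_const_iff)
  then show ?thesis
    using integral_nonneg_eq_0_iff_AE[of ?M "\<lambda>x. \<bar>v x\<bar>"] v by simp
qed

lemma AE_const_if_orthogonal_mean_zero_polynomials:
  fixes u :: "real \<Rightarrow> real"
  assumes "a < b" and u: "integrable (lebesgue_on {a..b}) u"
    and orth: "\<And>P. (LINT x|lebesgue_on {a..b}. poly P x) = 0 \<Longrightarrow>
      (LINT x|lebesgue_on {a..b}. u x * poly P x) = 0"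
  obtains c where "AE x in lebesgue_on {a..b}. u x = c"
proof -
  let ?M = "lebesgue_on {a..b}"
  have length: "measure ?M {a..b} = b - a"
    using \<open>a < b\<close> by (simp add: measure_restrict_space)
  have poly: "integrable ?M (poly P)" for P :: "real poly"
    by (intro continuous_imp_integrable_real continuous_intros)
  have upoly: "integrable ?M (\<lambda>x. u x * poly P x)" for P
    using u by (intro integrable_mult_continuous continuous_intros) auto
  define mean where "mean w = (LINT x|?M. w x) / (b - a)" for w :: "real \<Rightarrow> real"
  have mean: "(LINT x|?M. w x) = mean w * (b - a)" for w
    using \<open>a < b\<close> by (simp add: mean_def)
  define c where "c = mean u"
  have "(LINT x|?M. (u x - c) * poly P x) = 0" for P
  proof -
    define m where "m = mean (poly P)"
    have "(LINT x|?M. poly (P - [:m:]) x) = 0"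
      using poly by (simp add: mean[of "poly P"] m_def length)
    then have "(LINT x|?M. u x * poly (P - [:m:]) x) = 0"
      by (rule orth)
    moreover have "(LINT x|?M. m * u x - c * poly P x) = 0"
      using u poly by (simp add: mean[of u] mean[of "poly P"] c_def m_def)
    moreover have "(LINT x|?M. (u x - c) * poly P x)
        = (LINT x|?M. u x * poly (P - [:m:]) x + (m * u x - c * poly P x))"
      by (intro Bochner_Integration.integral_cong) (auto simp: algebra_simps)
    moreover have "\<dots> = (LINT x|?M. u x * poly (P - [:m:]) x) + (LINT x|?M. m * u x - c * poly P x)"
      by (intro Bochner_Integration.integral_add Bochner_Integration.integrable_diff
          integrable_mult_right upoly u poly)
    ultimately show ?thesis
      by simp
  qed
  moreover have "integrable ?M (\<lambda>x. u x - c)"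
    using u by simp
  ultimately have "AE x in ?M. u x - c = 0"
    by (intro AE_zero_if_orthogonal_polynomials)
  then show ?thesis
    using that by simp
qed

section \<open>Weak derivatives and primitives\<close>

lemma (in pair_sigma_finite) integrable_pair_mult:
  fixes u :: "'a \<Rightarrow> real" and v :: "'b \<Rightarrow> real"
  assumes "integrable M1 u" "integrable M2 v"
  shows "integrable (M1 \<Otimes>\<^sub>M M2) (\<lambda>(x, y). u x * v y)"
  using assms by (intro Fubini_integrable) (auto simp: case_prod_beta abs_mult)

lemma integral_restrict_below:
  fixes v :: "real \<Rightarrow> real"
  assumes v: "integrable (lebesgue_on {a..b}) v" and x: "x \<in> {a..b}"
  shows "(LINT t|lebesgue_on {a..b}. (if t \<le> x then v t else 0))
      = integral\<^sup>L (lebesgue_on {a..x}) v"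
    and "(LINT t|lebesgue_on {a..b}. (if t < x then v t else 0))
      = integral\<^sup>L (lebesgue_on {a..x}) v"
proof -
  let ?M = "lebesgue_on {a..b}"
  have "(LINT t|?M. (if t \<le> x then v t else 0)) = (LINT t|?M. (if t \<in> {a..x} then v t else 0))"
    by (intro Bochner_Integration.integral_cong) auto
  also have "\<dots> = integral\<^sup>L (lebesgue_on {a..x}) v"
    using x by (intro integral_restrict) auto
  finally show closed:
    "(LINT t|?M. (if t \<le> x then v t else 0)) = integral\<^sup>L (lebesgue_on {a..x}) v" .
  have [measurable]: "v \<in> borel_measurable ?M" "(\<lambda>t. t) \<in> borel_measurable ?M"
    using v by (auto intro: continuous_imp_measurable_on_sets_lebesgue)
  have "AE t in lebesgue. t \<noteq> x"
    using AE_lborel_singleton by (rule AE_completion)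
  then have "AE t in ?M. (if t < x then v t else 0) = (if t \<le> x then v t else 0)"
    by (auto simp: AE_restrict_space_iff elim!: eventually_mono)
  then have "(LINT t|?M. (if t < x then v t else 0)) = (LINT t|?M. (if t \<le> x then v t else 0))"
    by (intro integral_cong_AE) measurable
  with closed show "(LINT t|?M. (if t < x then v t else 0)) = integral\<^sup>L (lebesgue_on {a..x}) v"
    by simp
qed

text \<open>Fubini's theorem on the triangles below and above the diagonal.\<close>

lemma integral_by_parts_primitives:
  fixes u v :: "real \<Rightarrow> real"
  assumes u: "integrable (lebesgue_on {a..b}) u" and v: "integrable (lebesgue_on {a..b}) v"
  defines "U \<equiv> \<lambda>x. integral\<^sup>L (lebesgue_on {a..x}) u"
    and "V \<equiv> \<lambda>x. integral\<^sup>L (lebesgue_on {a..x}) v"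
  shows "(LINT x|lebesgue_on {a..b}. U x * v x) + (LINT x|lebesgue_on {a..b}. u x * V x)
    = integral\<^sup>L (lebesgue_on {a..b}) u * integral\<^sup>L (lebesgue_on {a..b}) v"
proof -
  let ?M = "lebesgue_on {a..b}"
  interpret finite_measure ?M
    by (rule finite_measure_lebesgue_on) simp
  interpret pair_sigma_finite ?M ?M ..
  have [measurable]: "(\<lambda>x. x) \<in> borel_measurable ?M"
    by (intro continuous_imp_measurable_on_sets_lebesgue) auto
  have uv: "integrable (?M \<Otimes>\<^sub>M ?M) (\<lambda>(x, y). u x * v y)"
    using u v by (rule integrable_pair_mult)
  define lower where "lower x y = u x * (if y \<le> x then v y else 0)" for x y
  define upper where "upper x y = (if x < y then u x else 0) * v y" for x y
  have measurable: "case_prod lower \<in> borel_measurable (?M \<Otimes>\<^sub>M ?M)"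
       "case_prod upper \<in> borel_measurable (?M \<Otimes>\<^sub>M ?M)"
    unfolding lower_def upper_def using u v by measurable
  have lower: "integrable (?M \<Otimes>\<^sub>M ?M) (case_prod lower)"
    by (rule Bochner_Integration.integrable_bound[OF uv measurable(1)]) (auto simp: lower_def)
  have upper: "integrable (?M \<Otimes>\<^sub>M ?M) (case_prod upper)"
    by (rule Bochner_Integration.integrable_bound[OF uv measurable(2)]) (auto simp: upper_def)
  have "(LINT y|?M. lower x y) = u x * V x" if "x \<in> {a..b}" for x
    using integral_restrict_below(1)[OF v that] by (simp add: V_def lower_def)
  then have "(LINT x|?M. u x * V x) = (LINT x|?M. LINT y|?M. lower x y)"
    by (intro Bochner_Integration.integral_cong) simp_all
  moreover have "(LINT x|?M. upper x y) = U y * v y" if "y \<in> {a..b}" for y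
    using integral_restrict_below(2)[OF u that] by (simp add: U_def upper_def)
  then have "(LINT y|?M. U y * v y) = (LINT y|?M. LINT x|?M. upper x y)"
    by (intro Bochner_Integration.integral_cong) simp_all
  moreover have "integral\<^sup>L (?M \<Otimes>\<^sub>M ?M) (case_prod upper) + integral\<^sup>L (?M \<Otimes>\<^sub>M ?M) (case_prod lower)
      = integral\<^sup>L (?M \<Otimes>\<^sub>M ?M) (\<lambda>(x, y). u x * v y)"
    unfolding Bochner_Integration.integral_add[OF upper lower, symmetric]
    by (intro Bochner_Integration.integral_cong) (auto simp: upper_def lower_def)
  ultimately show ?thesis
    using integral_fst[OF lower] integral_snd[OF upper] integral_fst[OF uv] by simp
qed

lemma integral_poly_pderiv:
  fixes Q :: "real poly"
  assumes "a \<le> b"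
  shows "integral\<^sup>L (lebesgue_on {a..b}) (poly (pderiv Q)) = poly Q b - poly Q a"
proof -
  have "(poly (pderiv Q) has_integral (poly Q b - poly Q a)) {a..b}"
    using assms
    by (intro fundamental_theorem_of_calculus)
      (auto simp: has_real_derivative_iff_has_vector_derivative[symmetric]
        intro: DERIV_subset[OF poly_DERIV subset_UNIV])
  moreover have "integrable (lebesgue_on {a..b}) (poly (pderiv Q))"
    by (intro continuous_imp_integrable_real continuous_intros)
  ultimately show ?thesis
    by (simp add: lebesgue_integral_eq_integral integral_unique)
qed

lemma surj_pderiv: "surj (pderiv :: real poly \<Rightarrow> real poly)"
proof (rule surjI)
  fix P :: "real poly"
  show "pderiv (\<Sum>i\<le>degree P. monom (coeff P i / real (Suc i)) (Suc i)) = P"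
    by (rule poly_eqI) (auto simp: coeff_pderiv coeff_sum coeff_eq_0 simp del: of_nat_Suc)
qed

lemma test_function_primitive_poly:
  assumes "(LINT x|lebesgue_on {0..1}. poly P x) = 0"
  obtains D where "test_function D" "D 1 = poly P"
    "\<And>x. x \<in> {0..1} \<Longrightarrow> D 0 x = integral\<^sup>L (lebesgue_on {0..x}) (poly P)"
proof -
  obtain R where R: "P = pderiv R"
    using surjD[OF surj_pderiv] by blast
  define Q where "Q = R - [:poly R 0:]"
  have Q: "pderiv Q = P" "poly Q 0 = 0"
    by (simp_all add: Q_def R pderiv_diff)
  have primitive: "poly Q x = integral\<^sup>L (lebesgue_on {0..x}) (poly P)" if "x \<in> {0..1}" for x
    using integral_poly_pderiv[of 0 x Q] that by (simp add: Q)
  define D where "D k = poly ((pderiv ^^ k) Q)" for k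
  have "(D k has_real_derivative D (Suc k) x) (at x within {0..1})" for k x
    unfolding D_def by (auto intro: DERIV_subset[OF poly_DERIV subset_UNIV])
  moreover have "D 0 1 = 0"
    using primitive[of 1] assms by (simp add: D_def)
  ultimately have "test_function D"
    by (simp add: test_function_def D_def Q)
  then show ?thesis
    using that[of D] primitive by (simp add: D_def Q)
qed

lemma integrable_if_Lp_funs_1:
  assumes "f \<in> Lp_funs 1"
  shows "integrable (lebesgue_on {0..1}) f"
  using assms by (auto simp: Lp_funs_def intro: integrable_abs_cancel)

lemma weak_derivative_orthogonal_poly:
  assumes fg: "weak_derivative f g" and P: "(LINT x|lebesgue_on {0..1}. poly P x) = 0"
  shows "(LINT x|lebesgue_on {0..1}. f x * poly P x)
    = (LINT x|lebesgue_on {0..1}. integral\<^sup>L (lebesgue_on {0..x}) g * poly P x)"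
proof -
  let ?M = "lebesgue_on {0..1::real}"
  obtain D where D: "test_function D" "D 1 = poly P"
    "\<And>x. x \<in> {0..1} \<Longrightarrow> D 0 x = integral\<^sup>L (lebesgue_on {0..x}) (poly P)"
    using test_function_primitive_poly[OF P] by blast
  have "(LINT x|?M. f x * poly P x) = - (LINT x|?M. g x * D 0 x)"
    using fg D(1,2) unfolding weak_derivative_def by metis
  also have "(LINT x|?M. g x * D 0 x)
      = (LINT x|?M. g x * integral\<^sup>L (lebesgue_on {0..x}) (poly P))"
    by (intro Bochner_Integration.integral_cong) (simp_all add: D(3))
  also have "- \<dots> = (LINT x|?M. integral\<^sup>L (lebesgue_on {0..x}) g * poly P x)"
  proof -
    have "integrable ?M g"
      using fg by (simp add: weak_derivative_def integrable_if_Lp_funs_1)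
    moreover have "integrable ?M (poly P)"
      by (intro continuous_imp_integrable_real continuous_intros)
    ultimately show ?thesis
      using integral_by_parts_primitives[of 0 1 g "poly P"] by (simp add: P)
  qed
  finally show ?thesis .
qed

lemma weak_derivative_AE_primitive:
  assumes fg: "weak_derivative f g"
  obtains c where "AE x in lebesgue_on {0..1}. f x = c + integral\<^sup>L (lebesgue_on {0..x}) g"
proof -
  let ?M = "lebesgue_on {0..1::real}"
  define G where "G x = integral\<^sup>L (lebesgue_on {0..x}) g" for x
  have f: "integrable ?M f" and g: "integrable ?M g"
    using fg by (auto simp: weak_derivative_def integrable_if_Lp_funs_1)
  have "continuous_on {0..1} G"
    unfolding G_def by (rule indefinite_integral_continuous_real[OF g])
  then have G: "integrable ?M G"
    by (rule continuous_imp_integrable_real)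
  have "(LINT x|?M. (f x - G x) * poly P x) = 0" if "(LINT x|?M. poly P x) = 0" for P
  proof -
    have "integrable ?M (\<lambda>x. w x * poly P x)" if "integrable ?M w" for w
      using that by (intro integrable_mult_continuous continuous_intros) auto
    then show ?thesis
      using weak_derivative_orthogonal_poly[OF fg that, folded G_def] f G
      by (simp add: left_diff_distrib)
  qed
  moreover have "integrable ?M (\<lambda>x. f x - G x)"
    using f G by simp
  ultimately obtain c where "AE x in ?M. f x - G x = c"
    using AE_const_if_orthogonal_mean_zero_polynomials[of 0 1 "\<lambda>x. f x - G x"] by auto
  then have "AE x in ?M. f x = c + G x"
    by eventually_elim simp
  then show ?thesis
    unfolding G_def by (rule that)
qed

section \<open>Translations and variation\<close>

lemma distr_lebesgue_translation: "distr lebesgue lebesgue ((+) h) = (lebesgue :: real measure)"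
  using lebesgue_real_affine[of 1 h] by (simp add: density_1)

lemma measurable_lebesgue_translation: "(+) h \<in> lebesgue \<rightarrow>\<^sub>M (lebesgue :: real measure)"
  using lebesgue_affine_measurable[of "\<lambda>_. 1" h] by simp

lemma AE_lebesgue_translation:
  fixes P :: "real \<Rightarrow> bool"
  assumes "AE x in lebesgue. P x"
  shows "AE x in lebesgue. P (x + h)"
  using AE_distrD[OF measurable_lebesgue_translation[of h], of P] assms
  unfolding distr_lebesgue_translation by (simp add: add.commute)

lemma
  fixes u :: "real \<Rightarrow> real"
  assumes "integrable lebesgue u"
  shows integrable_lebesgue_translation: "integrable lebesgue (\<lambda>x. u (x + h))"
    and integral_lebesgue_translation: "(LINT x|lebesgue. u (x + h)) = (LINT x|lebesgue. u x)"
  using lebesgue_integrable_real_affine[OF assms, of 1 h] lebesgue_integral_real_affine[of 1 u h]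
  by (simp_all add: add.commute)

definition variation_bound_on :: "real set \<Rightarrow> (real \<Rightarrow> real) \<Rightarrow> (real \<Rightarrow> real) \<Rightarrow> bool" where
  "variation_bound_on S W F \<longleftrightarrow> (\<forall>x\<in>S. \<forall>y\<in>S. x \<le> y \<longrightarrow> \<bar>F y - F x\<bar> \<le> W y - W x)"

lemma variation_bound_onD:
  "variation_bound_on S W F \<Longrightarrow> x \<in> S \<Longrightarrow> y \<in> S \<Longrightarrow> x \<le> y \<Longrightarrow> \<bar>F y - F x\<bar> \<le> W y - W x"
  by (simp add: variation_bound_on_def)

lemma variation_bound_on_mono_on:
  assumes "variation_bound_on S W F"
  shows "mono_on S W"
  using variation_bound_onD[OF assms] by (fastforce intro: mono_onI)

lemma variation_bound_on_abs_diff_le: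
  assumes "variation_bound_on S W F" "x \<in> S" "y \<in> S"
  shows "\<bar>F x - F y\<bar> \<le> \<bar>W x - W y\<bar>"
  using variation_bound_onD[OF assms(1), of x y] variation_bound_onD[OF assms(1), of y x] assms(2,3)
  by linarith

lemma variation_bound_on_primitive:
  fixes g :: "real \<Rightarrow> real"
  assumes g: "integrable (lebesgue_on {a..b}) g"
  shows "variation_bound_on {a..b} (\<lambda>x. LINT t|lebesgue_on {a..x}. \<bar>g t\<bar>)
    (\<lambda>x. c + integral\<^sup>L (lebesgue_on {a..x}) g)"
  unfolding variation_bound_on_def
proof (intro ballI impI)
  fix x y assume xy: "x \<in> {a..b}" "y \<in> {a..b}" "x \<le> y"
  have sub: "integrable (lebesgue_on {a..y}) g"
    using Equivalence_Lebesgue_Henstock_Integration.integrable_subinterval[OF g] xy by simp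
  have "integral\<^sup>L (lebesgue_on {a..y}) g - integral\<^sup>L (lebesgue_on {a..x}) g
      = integral\<^sup>L (lebesgue_on {x..y}) g"
    using Equivalence_Measurable_On_Borel.integral_combine[OF sub, of x] xy by simp
  also have "\<bar>\<dots>\<bar> \<le> (LINT t|lebesgue_on {x..y}. \<bar>g t\<bar>)"
    using integral_norm_bound[of "lebesgue_on {x..y}" g] by simp
  also have "\<dots> = (LINT t|lebesgue_on {a..y}. \<bar>g t\<bar>) - (LINT t|lebesgue_on {a..x}. \<bar>g t\<bar>)"
    using Equivalence_Measurable_On_Borel.integral_combine[OF integrable_abs[OF sub], of x] xy
    by simp
  finally show "\<bar>c + integral\<^sup>L (lebesgue_on {a..y}) g - (c + integral\<^sup>L (lebesgue_on {a..x}) g)\<bar>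
      \<le> (LINT t|lebesgue_on {a..y}. \<bar>g t\<bar>) - (LINT t|lebesgue_on {a..x}. \<bar>g t\<bar>)"
    by simp
qed

lemma has_integral_increment_mono:
  fixes W :: "real \<Rightarrow> real"
  assumes W: "mono W" "\<And>x. x < a \<Longrightarrow> W x = A" "\<And>x. b < x \<Longrightarrow> W x = C"
    and "a \<le> b" "0 \<le> h"
  shows "((\<lambda>x. W (x + h) - W x) has_integral h * (C - A)) UNIV"
proof -
  have inner: "(W has_integral integral {a..b} W) {a..b}"
    using W(1)
    by (intro integrable_integral integrable_on_mono_on) (auto simp: mono_on_def mono_def)
  have "(W has_integral h * A) {a - h..a}"
    using has_integral_spike_interior[of "\<lambda>_. A" "h * A" "a - h" a W]
      has_integral_const_real[of A "a - h" a] W(2) \<open>0 \<le> h\<close> by simp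
  then have unshifted: "(W has_integral h * A + integral {a..b} W) {a - h..b}"
    using inner by (rule has_integral_combine[rotated 2]) (use assms in auto)
  have "(W has_integral h * C) {b..b + h}"
    using has_integral_spike_interior[of "\<lambda>_. C" "h * C" b "b + h" W]
      has_integral_const_real[of C b "b + h"] W(3) \<open>0 \<le> h\<close> by simp
  with inner have "(W has_integral integral {a..b} W + h * C) {a..b + h}"
    by (rule has_integral_combine[rotated 2]) (use assms in auto)
  then have "((\<lambda>x. W (x + h)) has_integral integral {a..b} W + h * C) {a - h..b}"
    using has_integral_shift_real_ivl[of W _ a "b + h" h] by simp
  from has_integral_diff[OF this unshifted]
  have "((\<lambda>x. W (x + h) - W x) has_integral h * (C - A)) {a - h..b}"
    by (simp add: algebra_simps)
  then show ?thesis
    by (rule has_integral_on_superset) (use W(2,3) \<open>0 \<le> h\<close> in force)+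
qed

lemma has_bochner_integral_abs_increment_mono:
  fixes W :: "real \<Rightarrow> real"
  assumes W: "mono W" "\<And>x. x < a \<Longrightarrow> W x = A" "\<And>x. b < x \<Longrightarrow> W x = C" and "a \<le> b"
  shows "has_bochner_integral lebesgue (\<lambda>x. \<bar>W (x + h) - W x\<bar>) (\<bar>h\<bar> * (C - A))"
proof -
  have forward: "has_bochner_integral lebesgue (\<lambda>x. \<bar>W (x + t) - W x\<bar>) (t * (C - A))"
    if "0 \<le> t" for t
  proof -
    have "\<bar>W (x + t) - W x\<bar> = W (x + t) - W x" for x
      using monoD[OF W(1), of x "x + t"] that by simp
    then have increment: "((\<lambda>x. \<bar>W (x + t) - W x\<bar>) has_integral t * (C - A)) UNIV"
      using has_integral_increment_mono[OF assms that] by simp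
    then have "(\<lambda>x. \<bar>W (x + t) - W x\<bar>) absolutely_integrable_on UNIV"
      by (intro nonnegative_absolutely_integrable_1) auto
    then have "integrable lebesgue (\<lambda>x. \<bar>W (x + t) - W x\<bar>)"
      by (simp add: set_integrable_def)
    then show ?thesis
      using has_integral_unique[OF has_integral_integral_lebesgue increment]
      by (simp add: has_bochner_integral_iff)
  qed
  show ?thesis
  proof (cases "0 \<le> h")
    case True
    then show ?thesis using forward by simp
  next
    case False
    then have "has_bochner_integral lebesgue (\<lambda>x. \<bar>W (x + - h) - W x\<bar>) (- h * (C - A))"
      by (intro forward) simp
    then show ?thesis
      using has_bochner_integral_lebesgue_real_affine_iff[of 1 "\<lambda>x. \<bar>W (x + - h) - W x\<bar>" _ h] False
      by (simp add: add.commute abs_minus_commute)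
  qed
qed

lemma powr_le_powr_mult:
  fixes t b p :: real
  assumes "0 \<le> t" "t \<le> b" "1 \<le> p"
  shows "t powr p \<le> b powr (p - 1) * t"
proof (cases "t = 0")
  case False
  then have "t powr p = t powr (p - 1) * t"
    using assms powr_add[of t "p - 1" 1] by simp
  also have "\<dots> \<le> b powr (p - 1) * t"
    using assms by (intro mult_right_mono powr_mono2) auto
  finally show ?thesis .
qed simp

lemma integral_powr_translation_diff_le:
  fixes u F W :: "real \<Rightarrow> real"
  assumes var: "variation_bound_on UNIV W F" and B: "\<And>x. \<bar>F x\<bar> \<le> B"
    and W: "\<And>x. x < a \<Longrightarrow> W x = A" "\<And>x. b < x \<Longrightarrow> W x = C" and "a \<le> b"
    and u: "AE x in lebesgue. u x = F x" and p: "1 \<le> p"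
  shows "(LINT x|lebesgue. \<bar>u x - u (x + h)\<bar> powr p) \<le> (2 * B) powr (p - 1) * (\<bar>h\<bar> * (C - A))"
proof -
  note W_increments =
    has_bochner_integral_abs_increment_mono[OF variation_bound_on_mono_on[OF var] W \<open>a \<le> b\<close>, of h]
  have F: "\<bar>F x - F (x + h)\<bar> powr p \<le> (2 * B) powr (p - 1) * \<bar>W (x + h) - W x\<bar>" for x
  proof -
    have "\<bar>F x - F (x + h)\<bar> \<le> 2 * B"
      using B[of x] B[of "x + h"] by linarith
    then have "\<bar>F x - F (x + h)\<bar> powr p \<le> (2 * B) powr (p - 1) * \<bar>F x - F (x + h)\<bar>"
      using p by (intro powr_le_powr_mult) auto
    also have "\<dots> \<le> (2 * B) powr (p - 1) * \<bar>W (x + h) - W x\<bar>"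
      using variation_bound_on_abs_diff_le[OF var, of x "x + h"]
      by (intro mult_left_mono) (simp_all add: abs_minus_commute)
    finally show ?thesis .
  qed
  have "AE x in lebesgue. \<bar>u x - u (x + h)\<bar> powr p \<le> (2 * B) powr (p - 1) * \<bar>W (x + h) - W x\<bar>"
    using u AE_lebesgue_translation[OF u, of h] by eventually_elim (simp add: F)
  then have "(LINT x|lebesgue. \<bar>u x - u (x + h)\<bar> powr p)
      \<le> (LINT x|lebesgue. (2 * B) powr (p - 1) * \<bar>W (x + h) - W x\<bar>)"
    using W_increments by (intro integral_mono_AE') (auto simp: has_bochner_integral_iff)
  then show ?thesis
    using W_increments by (simp add: has_bochner_integral_iff)
qed

section \<open>Zero extensions\<close>

lemma integrable_zero_extension_iff:
  "integrable lebesgue (zero_extension u) \<longleftrightarrow> integrable (lebesgue_on {0..1}) u"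
  unfolding zero_extension_def by (rule Lebesgue_Measure.integrable_restrict_UNIV) simp

lemma integral_zero_extension:
  "integral\<^sup>L lebesgue (zero_extension u) = integral\<^sup>L (lebesgue_on {0..1}) u"
  unfolding zero_extension_def by (rule Lebesgue_Measure.integral_restrict_UNIV) simp

lemma zero_extension_comp: "f 0 = 0 \<Longrightarrow> zero_extension (\<lambda>x. f (u x)) = (\<lambda>x. f (zero_extension u x))"
  by (simp add: zero_extension_def fun_eq_iff)

lemma AE_zero_extension_eq:
  assumes "AE x in lebesgue_on {0..1}. f x = g x"
  shows "AE x in lebesgue. zero_extension f x = zero_extension g x"
  using assms by (auto simp: AE_restrict_space_iff zero_extension_def elim!: eventually_mono)

text \<open>The zero extension jumps by at most \<open>B\<close> at each end point.\<close>

definition zero_extension_variation :: "real \<Rightarrow> (real \<Rightarrow> real) \<Rightarrow> real \<Rightarrow> real" where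
  "zero_extension_variation B V x =
    (if x < 0 then 0 else if x \<le> 1 then B + (V x - V 0) else 2 * B + (V 1 - V 0))"

lemma variation_bound_on_zero_extension:
  assumes var: "variation_bound_on {0..1} V F" and B: "\<And>x. x \<in> {0..1} \<Longrightarrow> \<bar>F x\<bar> \<le> B"
  shows "variation_bound_on UNIV (zero_extension_variation B V) (zero_extension F)"
  unfolding variation_bound_on_def
proof (intro ballI impI)
  fix x y :: real assume "x \<le> y"
  have V: "V s \<le> V t" if "0 \<le> s" "s \<le> t" "t \<le> 1" for s t
    using variation_bound_onD[OF var, of s t] that by simp
  have "0 \<le> B"
    using B[of 0] by simp
  consider "y < 0" | "x < 0" "y \<in> {0..1}" | "x < 0" "1 < y" | "x \<in> {0..1}" "y \<in> {0..1}"
    | "x \<in> {0..1}" "1 < y" | "1 < x"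
    using \<open>x \<le> y\<close> by fastforce
  then show "\<bar>zero_extension F y - zero_extension F x\<bar>
      \<le> zero_extension_variation B V y - zero_extension_variation B V x"
  proof cases
    case 2
    then show ?thesis
      using B[of y] V[of 0 y] by (simp add: zero_extension_def zero_extension_variation_def)
  next
    case 3
    then show ?thesis
      using V[of 0 1] \<open>0 \<le> B\<close> by (simp add: zero_extension_def zero_extension_variation_def)
  next
    case 4
    then show ?thesis
      using variation_bound_onD[OF var _ _ \<open>x \<le> y\<close>]
      by (simp add: zero_extension_def zero_extension_variation_def)
  next
    case 5
    then show ?thesis
      using B[of x] V[of x 1] by (simp add: zero_extension_def zero_extension_variation_def)
  qed (use \<open>x \<le> y\<close> in \<open>simp_all add: zero_extension_def zero_extension_variation_def\<close>)
qed

lemma Lp_norm_translation_zero_extension_le: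
  assumes var: "variation_bound_on {0..1} V F" and B: "\<And>x. x \<in> {0..1} \<Longrightarrow> \<bar>F x\<bar> \<le> B"
    and V: "V 1 - V 0 \<le> 2 * B" and f: "AE x in lebesgue_on {0..1}. f x = F x" and p: "1 \<le> p"
  shows "Lp_norm_line p (\<lambda>x. zero_extension f x - zero_extension f (x + h))
    \<le> 4 * B * \<bar>h\<bar> powr (1 / p)"
proof -
  define I where "I = (LINT x|lebesgue. \<bar>zero_extension f x - zero_extension f (x + h)\<bar> powr p)"
  have "0 \<le> B"
    using B[of 0] by simp
  have "I \<le> (2 * B) powr (p - 1) * (\<bar>h\<bar> * (2 * B + (V 1 - V 0) - 0))"
    unfolding I_def
  proof (rule integral_powr_translation_diff_le[where
        W = "zero_extension_variation B V" and F = "zero_extension F" and a = 0 and b = 1])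
    show "variation_bound_on UNIV (zero_extension_variation B V) (zero_extension F)"
      using var B by (rule variation_bound_on_zero_extension)
    show "\<bar>zero_extension F x\<bar> \<le> B" for x
      using B[of x] \<open>0 \<le> B\<close> by (simp add: zero_extension_def)
  qed (use f p in \<open>auto simp: zero_extension_variation_def intro: AE_zero_extension_eq\<close>)
  also have "\<dots> \<le> (4 * B) powr (p - 1) * (\<bar>h\<bar> * (4 * B))"
    using \<open>0 \<le> B\<close> V p variation_bound_onD[OF var, of 0 1]
    by (intro mult_mono powr_mono2 mult_left_mono mult_nonneg_nonneg) auto
  also have "\<dots> = (4 * B) powr p * \<bar>h\<bar>"
    using powr_add[of "4 * B" "p - 1" 1] \<open>0 \<le> B\<close> p by (cases "B = 0") auto
  finally have "I powr (1 / p) \<le> ((4 * B) powr p * \<bar>h\<bar>) powr (1 / p)"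
    using p by (intro powr_mono2) (auto simp: I_def)
  also have "\<dots> = 4 * B * \<bar>h\<bar> powr (1 / p)"
    using \<open>0 \<le> B\<close> p by (simp add: powr_mult powr_powr)
  finally show ?thesis
    by (simp add: Lp_norm_line_def I_def)
qed

section \<open>Bounds on a function from its modulus\<close>

lemma integral_abs_le_translation_diff:
  fixes u :: "real \<Rightarrow> real"
  assumes u: "integrable lebesgue u" and supp: "\<And>x. x \<notin> {a..b} \<Longrightarrow> u x = 0"
    and n: "b - a < real n * h"
  shows "(LINT x|lebesgue. \<bar>u x\<bar>) \<le> real n * (LINT x|lebesgue. \<bar>u x - u (x + h)\<bar>)"
proof -
  define d where "d x = \<bar>u x - u (x + h)\<bar>" for x
  have d: "integrable lebesgue d"
    unfolding d_def
    by (intro integrable_abs Bochner_Integration.integrable_diff u integrable_lebesgue_translation)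
  note d_translation = integrable_lebesgue_translation[OF d] integral_lebesgue_translation[OF d]
  have telescope: "\<bar>u x\<bar> \<le> (\<Sum>k<n. d (x + real k * h))" for x
  proof (cases "x \<in> {a..b}")
    case True
    have "(\<Sum>k<n. u (x + real k * h) - u (x + real k * h + h)) = u x - u (x + real n * h)"
      using sum_lessThan_telescope'[of "\<lambda>k. u (x + real k * h)" n] by (simp add: algebra_simps)
    also have "u (x + real n * h) = 0"
      using True n by (intro supp) auto
    finally show ?thesis
      using sum_abs[of "\<lambda>k. u (x + real k * h) - u (x + real k * h + h)" "{..<n}"]
      by (simp add: d_def)
  qed (simp add: supp d_def sum_nonneg)
  have "(LINT x|lebesgue. \<bar>u x\<bar>) \<le> (LINT x|lebesgue. (\<Sum>k<n. d (x + real k * h)))"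
    using u d_translation(1)
    by (intro integral_mono Bochner_Integration.integrable_sum telescope) auto
  also have "\<dots> = (\<Sum>k<n. (LINT x|lebesgue. d (x + real k * h)))"
    by (intro Bochner_Integration.integral_sum d_translation)
  also have "\<dots> = real n * (LINT x|lebesgue. d x)"
    by (simp add: d_translation(2))
  finally show ?thesis
    unfolding d_def .
qed

lemma integral_abs_le_measure_plus_powr:
  fixes u :: "'a \<Rightarrow> real"
  assumes "integrable M u" and u_powr: "integrable M (\<lambda>x. \<bar>u x\<bar> powr p)" and p: "1 \<le> p"
    and S: "S \<in> sets M" "emeasure M S < \<infinity>" and supp: "\<And>x. x \<notin> S \<Longrightarrow> u x = 0"
  shows "(LINT x|M. \<bar>u x\<bar>) \<le> measure M S + (LINT x|M. \<bar>u x\<bar> powr p)"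
proof -
  have "\<bar>u x\<bar> \<le> indicator S x + \<bar>u x\<bar> powr p" for x
  proof (cases "x \<in> S")
    case True
    then show ?thesis
      using powr_mono[of 1 p "\<bar>u x\<bar>"] p by (cases "\<bar>u x\<bar> \<le> 1") (auto intro: add_increasing2)
  qed (simp add: supp)
  then have "(LINT x|M. \<bar>u x\<bar>) \<le> (LINT x|M. indicator S x + \<bar>u x\<bar> powr p)"
    using assms by (intro integral_mono Bochner_Integration.integrable_add) auto
  also have "\<dots> = measure M S + (LINT x|M. \<bar>u x\<bar> powr p)"
    using S u_powr by (simp add: sets.Int_space_eq2)
  finally show ?thesis .
qed

lemma abs_diff_powr_le:
  fixes a b p :: real
  assumes "0 \<le> p"
  shows "\<bar>a - b\<bar> powr p \<le> 2 powr p * (\<bar>a\<bar> powr p + \<bar>b\<bar> powr p)"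
proof -
  let ?m = "max \<bar>a\<bar> \<bar>b\<bar>"
  have "\<bar>a - b\<bar> powr p \<le> (2 * ?m) powr p"
    using assms by (intro powr_mono2) auto
  also have "\<dots> = 2 powr p * ?m powr p"
    by (simp add: powr_mult)
  also have "?m powr p \<le> \<bar>a\<bar> powr p + \<bar>b\<bar> powr p"
    by (simp add: max_def)
  finally show ?thesis by simp
qed

lemma integrable_abs_diff_powr:
  fixes u v :: "'a \<Rightarrow> real"
  assumes [measurable]: "u \<in> borel_measurable M" "v \<in> borel_measurable M"
    and "integrable M (\<lambda>x. \<bar>u x\<bar> powr p)" "integrable M (\<lambda>x. \<bar>v x\<bar> powr p)" "0 \<le> p"
  shows "integrable M (\<lambda>x. \<bar>u x - v x\<bar> powr p)"
proof (rule Bochner_Integration.integrable_bound)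
  show "integrable M (\<lambda>x. 2 powr p * (\<bar>u x\<bar> powr p + \<bar>v x\<bar> powr p))"
    using assms by simp
qed (use abs_diff_powr_le[OF \<open>0 \<le> p\<close>] in auto)

lemma Lp_modulusD:
  assumes "Lp_modulus p g \<mu>" "\<bar>h\<bar> \<le> 1 / 2 ^ \<mu> n"
  shows "Lp_norm_line p (\<lambda>x. zero_extension g x - zero_extension g (x + h)) < 1 / 2 ^ n"
  using assms by (simp add: Lp_modulus_def)

lemma integral_abs_le_if_Lp_modulus:
  assumes modulus: "Lp_modulus p g \<mu>" and p: "1 \<le> p" and g: "integrable (lebesgue_on {0..1}) g"
  shows "(LINT x|lebesgue_on {0..1}. \<bar>g x\<bar>) \<le> 6 * 2 ^ \<mu> 0"
proof -
  let ?g = "zero_extension g"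
  define h :: real where "h = 1 / 2 ^ \<mu> 0"
  have h: "0 < h" "h \<le> 1" by (simp_all add: h_def)
  define d where "d x = ?g x - ?g (x + h)" for x
  have g_extended: "integrable lebesgue ?g"
    using g by (simp add: integrable_zero_extension_iff)
  then have d: "integrable lebesgue d"
    unfolding d_def by (intro Bochner_Integration.integrable_diff integrable_lebesgue_translation)
  have "integrable lebesgue (zero_extension (\<lambda>x. \<bar>g x\<bar> powr p))"
    using modulus by (simp add: integrable_zero_extension_iff Lp_modulus_def Lp_funs_def)
  then have "integrable lebesgue (\<lambda>x. \<bar>?g x\<bar> powr p)"
    by (simp add: zero_extension_comp[of "\<lambda>y. \<bar>y\<bar> powr p"])
  then have d_powr: "integrable lebesgue (\<lambda>x. \<bar>d x\<bar> powr p)"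
    unfolding d_def using g_extended p integrable_lebesgue_translation[OF g_extended, of h]
      integrable_lebesgue_translation[of "\<lambda>x. \<bar>?g x\<bar> powr p" h]
    by (intro integrable_abs_diff_powr) auto
  have "Lp_norm_line p d < 1"
    using Lp_modulusD[OF modulus, of h 0] by (simp add: d_def[abs_def] h_def)
  then have "(LINT x|lebesgue. \<bar>d x\<bar> powr p) \<le> 1"
    using p ge_one_powr_ge_zero[of "LINT x|lebesgue. \<bar>d x\<bar> powr p" "1 / p"]
    unfolding Lp_norm_line_def by force
  moreover have "d x = 0" if "x \<notin> {-1..1}" for x
    using that h by (auto simp: d_def zero_extension_def)
  ultimately have d_le: "(LINT x|lebesgue. \<bar>d x\<bar>) \<le> 3"
    using integral_abs_le_measure_plus_powr[OF d d_powr p, of "{-1..1}"] by simp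
  have "(LINT x|lebesgue_on {0..1}. \<bar>g x\<bar>) = (LINT x|lebesgue. \<bar>?g x\<bar>)"
    using integral_zero_extension[of "\<lambda>x. \<bar>g x\<bar>"] by (simp add: zero_extension_comp[of abs])
  also have "\<dots> \<le> real (2 * 2 ^ \<mu> 0) * (LINT x|lebesgue. \<bar>d x\<bar>)"
    unfolding d_def using g_extended
    by (rule integral_abs_le_translation_diff[where a = 0 and b = 1])
      (auto simp: zero_extension_def h_def)
  also have "\<dots> \<le> real (2 * 2 ^ \<mu> 0) * 3"
    using d_le by (intro mult_left_mono) auto
  finally show ?thesis
    by simp
qed

lemma abs_le_mean_plus_oscillation:
  fixes F :: "real \<Rightarrow> real"
  assumes "a < b" and F: "integrable (lebesgue_on {a..b}) F"
    and osc: "\<And>y. y \<in> {a..b} \<Longrightarrow> \<bar>F x - F y\<bar> \<le> V"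
  shows "\<bar>F x\<bar> \<le> \<bar>integral\<^sup>L (lebesgue_on {a..b}) F\<bar> / (b - a) + V"
proof -
  let ?M = "lebesgue_on {a..b}"
  have length: "measure ?M {a..b} = b - a"
    using \<open>a < b\<close> by (simp add: measure_restrict_space)
  have "F x * (b - a) - integral\<^sup>L ?M F = (LINT y|?M. F x - F y)"
    using F by (simp add: length)
  also have "\<bar>\<dots>\<bar> \<le> (LINT y|?M. \<bar>F x - F y\<bar>)"
    using integral_norm_bound[of ?M "\<lambda>y. F x - F y"] by simp
  also have "\<dots> \<le> (LINT y|?M. V)"
    using F osc by (intro integral_mono) auto
  finally have "\<bar>F x * (b - a) - integral\<^sup>L ?M F\<bar> \<le> V * (b - a)"
    by (simp add: length mult.commute)
  then have "\<bar>F x * (b - a)\<bar> \<le> \<bar>integral\<^sup>L ?M F\<bar> + V * (b - a)"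
    by linarith
  then show ?thesis
    using \<open>a < b\<close> by (simp add: abs_mult field_simps)
qed

lemma abs_primitive_le:
  fixes f g :: "real \<Rightarrow> real"
  assumes "a < b" and g: "integrable (lebesgue_on {a..b}) g"
    and f: "f \<in> borel_measurable (lebesgue_on {a..b})"
      "AE x in lebesgue_on {a..b}. f x = c + integral\<^sup>L (lebesgue_on {a..x}) g" and "x \<in> {a..b}"
  shows "\<bar>c + integral\<^sup>L (lebesgue_on {a..x}) g\<bar>
    \<le> \<bar>integral\<^sup>L (lebesgue_on {a..b}) f\<bar> / (b - a) + (LINT t|lebesgue_on {a..b}. \<bar>g t\<bar>)"
proof -
  let ?M = "lebesgue_on {a..b}"
  define F where "F x = c + integral\<^sup>L (lebesgue_on {a..x}) g" for x
  define V where "V x = (LINT t|lebesgue_on {a..x}. \<bar>g t\<bar>)" for x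
  have var: "variation_bound_on {a..b} V F"
    unfolding V_def F_def by (rule variation_bound_on_primitive[OF g])
  have "continuous_on {a..b} F"
    unfolding F_def by (intro continuous_intros indefinite_integral_continuous_real[OF g])
  then have F: "integrable ?M F"
    by (rule continuous_imp_integrable_real)
  have "\<bar>F x - F y\<bar> \<le> V b" if "y \<in> {a..b}" for y
  proof -
    have V: "0 \<le> V z" "V z \<le> V b" if "z \<in> {a..b}" for z
      using mono_onD[OF variation_bound_on_mono_on[OF var], of z b] that \<open>a < b\<close>
      by (simp add: V_def, simp)
    show ?thesis
      using variation_bound_on_abs_diff_le[OF var \<open>x \<in> {a..b}\<close> that] V[of x] V[of y] that
        \<open>x \<in> {a..b}\<close>
      by linarith
  qed
  from abs_le_mean_plus_oscillation[OF \<open>a < b\<close> F this]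
  have "\<bar>F x\<bar> \<le> \<bar>integral\<^sup>L ?M F\<bar> / (b - a) + V b" .
  moreover have "integral\<^sup>L ?M f = integral\<^sup>L ?M F"
    using F f by (intro integral_cong_AE) (auto simp: F_def)
  ultimately show ?thesis
    by (simp add: F_def V_def)
qed

section \<open>Moduli of weakly differentiable functions\<close>

lemma powr_inverse_le_inverse_power2:
  fixes t p :: real
  assumes "0 < p" "0 \<le> t" "t \<le> 1 / 2 ^ N" "p * real n \<le> real N"
  shows "t powr (1 / p) \<le> 1 / 2 ^ n"
proof -
  have "t \<le> 2 powr - real N"
    using assms(3) by (simp add: powr_minus powr_realpow divide_inverse)
  also have "\<dots> \<le> 2 powr - (p * real n)"
    using assms(4) by (intro powr_mono) auto
  finally have "t powr (1 / p) \<le> (2 powr - (p * real n)) powr (1 / p)"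
    using assms(1,2) by (intro powr_mono2) auto
  also have "\<dots> = 2 powr - real n"
    using assms(1) by (simp add: powr_powr)
  also have "\<dots> = 1 / 2 ^ n"
    by (simp add: powr_minus powr_realpow divide_inverse)
  finally show ?thesis .
qed

lemma Lp_norm_translation_le_if_weak_derivative:
  assumes p: "1 \<le> p" and fg: "weak_derivative f g"
    and modulus: "Lp_modulus p g \<mu>" "\<mu> 0 \<le> m"
    and mean: "\<bar>integral\<^sup>L (lebesgue_on {0..1}) f\<bar> \<le> 2 ^ m + 1"
  shows "Lp_norm_line p (\<lambda>x. zero_extension f x - zero_extension f (x + h))
    \<le> 2 ^ (m + 5) * \<bar>h\<bar> powr (1 / p)"
proof -
  have f: "integrable (lebesgue_on {0..1}) f" and g: "integrable (lebesgue_on {0..1}) g"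
    using fg by (auto simp: weak_derivative_def integrable_if_Lp_funs_1)
  obtain c where c: "AE x in lebesgue_on {0..1}. f x = c + integral\<^sup>L (lebesgue_on {0..x}) g"
    using weak_derivative_AE_primitive[OF fg] .
  define V where "V x = (LINT t|lebesgue_on {0..x}. \<bar>g t\<bar>)" for x
  have "(2::real) ^ \<mu> 0 \<le> 2 ^ m"
    using modulus(2) by simp
  then have V: "V 1 \<le> 6 * 2 ^ m" "0 \<le> V 0"
    using integral_abs_le_if_Lp_modulus[OF modulus(1) p g] unfolding V_def by (linarith, simp)
  have "(1::real) \<le> 2 ^ m" by simp
  have "Lp_norm_line p (\<lambda>x. zero_extension f x - zero_extension f (x + h))
      \<le> 4 * (8 * 2 ^ m) * \<bar>h\<bar> powr (1 / p)"
  proof (rule Lp_norm_translation_zero_extension_le[OF _ _ _ c p])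
    show "variation_bound_on {0..1} V (\<lambda>x. c + integral\<^sup>L (lebesgue_on {0..x}) g)"
      unfolding V_def by (rule variation_bound_on_primitive[OF g])
    show "\<bar>c + integral\<^sup>L (lebesgue_on {0..x}) g\<bar> \<le> 8 * 2 ^ m" if "x \<in> {0..1}" for x
      using abs_primitive_le[OF zero_less_one g borel_measurable_integrable[OF f] c that]
        mean V(1) \<open>1 \<le> 2 ^ m\<close>
      unfolding V_def diff_zero div_by_1 by linarith
    show "V 1 - V 0 \<le> 2 * (8 * 2 ^ m)"
      using V \<open>1 \<le> 2 ^ m\<close> by linarith
  qed
  then show ?thesis
    by (simp add: power_add mult.commute)
qed

lemma Lp_modulus_if_weak_derivative:
  assumes p: "1 \<le> p" "p \<le> real k" and f: "f \<in> Lp_funs p" and fg: "weak_derivative f g"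
    and modulus: "Lp_modulus p g \<mu>" "\<mu> 0 \<le> m"
    and mean: "\<bar>integral\<^sup>L (lebesgue_on {0..1}) f\<bar> \<le> 2 ^ m + 1"
    and \<nu>: "\<And>n. k * (n + m + 6) \<le> \<nu> n" "strict_mono \<nu>"
  shows "Lp_modulus p f \<nu>"
  unfolding Lp_modulus_def
proof (intro conjI allI impI f strict_monoD[OF \<nu>(2)] lessI)
  fix n and h :: real assume h: "\<bar>h\<bar> \<le> 1 / 2 ^ \<nu> n"
  have "p * real (n + m + 6) \<le> real k * real (n + m + 6)"
    using p by (intro mult_right_mono) auto
  also have "\<dots> \<le> real (\<nu> n)"
    using \<nu>(1)[of n] by (metis of_nat_le_iff of_nat_mult)
  finally have "\<bar>h\<bar> powr (1 / p) \<le> 1 / 2 ^ (n + m + 6)"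
    using p h by (intro powr_inverse_le_inverse_power2) auto
  then have "2 ^ (m + 5) * \<bar>h\<bar> powr (1 / p) \<le> 2 ^ (m + 5) * (1 / 2 ^ (n + m + 6))"
    by (intro mult_left_mono) auto
  also have "\<dots> < 1 / 2 ^ n"
    by (simp add: power_add field_simps)
  finally show "Lp_norm_line p (\<lambda>x. zero_extension f x - zero_extension f (x + h)) < 1 / 2 ^ n"
    using Lp_norm_translation_le_if_weak_derivative[OF p(1) fg modulus mean, of h] by linarith
qed

section \<open>Padded names\<close>

lemma interval_integral_lebesgue_eq_integral:
  fixes f :: "real \<Rightarrow> real"
  assumes "a \<le> b"
  shows "(LINT x=ereal a..ereal b|lebesgue. f x) = (LINT x|lebesgue_on {a..b}. f x)"
proof -
  have "(LINT x=ereal a..ereal b|lebesgue. f x) = (LINT x|lebesgue. indicator {a<..<b} x *\<^sub>R f x)"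
    using assms by (simp add: interval_lebesgue_integral_def set_lebesgue_integral_def)
  also have "\<dots> = (LINT x|lebesgue. indicator {a..b} x *\<^sub>R f x)"
    by (rule integral_discrete_difference[of "{a, b}"]) (auto simp: indicator_def)
  also have "\<dots> = (LINT x|lebesgue_on {a..b}. f x)"
    by (simp add: integral_restrict_space)
  finally show ?thesis .
qed

definition approximates_integrals :: "(str \<Rightarrow> str \<Rightarrow> str) \<Rightarrow> strfun \<Rightarrow> (real \<Rightarrow> real) \<Rightarrow> bool" where
  "approximates_integrals pr \<phi> f \<longleftrightarrow>
    (\<forall>a b n. dyadic a \<in> {0..1} \<and> dyadic b \<in> {0..1} \<longrightarrow>
      \<bar>(LINT x=ereal (dyadic a)..ereal (dyadic b)|lebesgue. f x)
        - dyadic (\<phi> (triple pr a b (ones n)))\<bar> < 1 / 2 ^ n)"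

lemma xi_iff_approximates_integrals:
  "xi pr m p \<phi> F \<longleftrightarrow> F \<in> sobolev_space m p \<and> length_monotone \<phi> \<and>
    (\<exists>f\<in>F. approximates_integrals pr \<phi> f \<and>
      (\<exists>g. (weak_derivative ^^ m) f g \<and> Lp_modulus p g (fun_size \<phi>)))"
  by (simp add: xi_def approximates_integrals_def)

lemma approximates_integrals_padded:
  "approximates_integrals pr (padded k m \<phi>) f \<longleftrightarrow> approximates_integrals pr \<phi> f"
  by (simp add: approximates_integrals_def dyadic_padded)

definition one_code :: str where
  "one_code = [False, True, False, True]"

lemma dyadic_one_code: "dyadic one_code = 1"
  by (simp add: one_code_def Let_def)

lemma abs_integral_le_if_approximates_integrals:
  assumes \<phi>: "length_monotone \<phi>" and approx: "approximates_integrals pr \<phi> f"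
    and m: "length (triple pr [] one_code (ones 0)) \<le> m"
  shows "\<bar>integral\<^sup>L (lebesgue_on {0..1}) f\<bar> \<le> 2 ^ fun_size \<phi> m + 1"
proof -
  define w where "w = \<phi> (triple pr [] one_code (ones 0))"
  have "\<bar>integral\<^sup>L (lebesgue_on {0..1}) f - dyadic w\<bar> < 1"
    using approx[unfolded approximates_integrals_def, rule_format, of "[]" one_code 0]
      interval_integral_lebesgue_eq_integral[of 0 1 f]
    by (simp add: dyadic_one_code w_def)
  moreover have "length w \<le> fun_size \<phi> m"
    using length_eq_fun_size[OF \<phi>] monoD[OF fun_size_mono[OF \<phi>] m] by (simp add: w_def)
  then have "(2::real) ^ length w \<le> 2 ^ fun_size \<phi> m"
    by simp
  ultimately show ?thesis
    using abs_dyadic_le[of w] by linarith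
qed

lemma strict_mono_fun_size_padded:
  assumes "length_monotone \<phi>" "1 \<le> k"
  shows "strict_mono (fun_size (padded k m \<phi>))"
proof (rule strict_monoI)
  fix i j :: nat assume "i < j"
  then have "fun_size \<phi> i \<le> fun_size \<phi> j"
    by (intro monoD[OF fun_size_mono[OF assms(1)]]) simp
  moreover have "2 * k * fun_size \<phi> (i + m) \<le> 2 * k * fun_size \<phi> (j + m)"
    using \<open>i < j\<close> by (intro mult_le_mono2 monoD[OF fun_size_mono[OF assms(1)]]) simp
  moreover have "2 * k * i < 2 * k * j"
    using \<open>i < j\<close> assms(2) by simp
  ultimately show "fun_size (padded k m \<phi>) i < fun_size (padded k m \<phi>) j"
    unfolding fun_size_padded pad_length_def by linarith
qed

lemma le_fun_size_padded:
  assumes "length_monotone \<phi>" "6 * k \<le> m"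
  shows "k * (n + fun_size \<phi> m + 6) \<le> fun_size (padded k m \<phi>) n"
proof -
  have "k * (n + fun_size \<phi> m + 6) = 6 * k + k * n + k * fun_size \<phi> m"
    by (simp add: algebra_simps)
  also have "\<dots> \<le> m + 2 * k * n + 2 * k * fun_size \<phi> (n + m)"
    using assms(2) monoD[OF fun_size_mono[OF assms(1)], of m "n + m"]
    by (intro add_mono mult_le_mono) auto
  finally show ?thesis
    by (simp add: fun_size_padded pad_length_def)
qed

lemma Lp_funs_if_mem_Lp_space: "F \<in> Lp_space p \<Longrightarrow> f \<in> F \<Longrightarrow> f \<in> Lp_funs p"
  by (auto simp: Lp_space_def quotient_def ae_eq_def)

lemma xi_0_padded:
  assumes p: "1 \<le> p" "p \<le> real k" and name: "xi pr 1 p \<phi> F"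
    and m: "6 * k \<le> m" "length (triple pr [] one_code (ones 0)) \<le> m"
  shows "xi pr 0 p (padded k m \<phi>) F"
proof -
  from name obtain f g where F: "F \<in> Lp_space p" "f \<in> F" and \<phi>: "length_monotone \<phi>"
    and approx: "approximates_integrals pr \<phi> f"
    and fg: "weak_derivative f g" and modulus: "Lp_modulus p g (fun_size \<phi>)"
    by (auto simp: xi_iff_approximates_integrals sobolev_space_def eq_OO)
  have "Lp_modulus p f (fun_size (padded k m \<phi>))"
  proof (rule Lp_modulus_if_weak_derivative[OF p _ fg modulus])
    show "f \<in> Lp_funs p"
      using F by (rule Lp_funs_if_mem_Lp_space)
    show "fun_size \<phi> 0 \<le> fun_size \<phi> m"
      using fun_size_mono[OF \<phi>] by (simp add: monoD)
    show "\<bar>integral\<^sup>L (lebesgue_on {0..1}) f\<bar> \<le> 2 ^ fun_size \<phi> m + 1"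
      using \<phi> approx m(2) by (rule abs_integral_le_if_approximates_integrals)
    show "k * (n + fun_size \<phi> m + 6) \<le> fun_size (padded k m \<phi>) n" for n
      using \<phi> m(1) by (rule le_fun_size_padded)
    show "strict_mono (fun_size (padded k m \<phi>))"
      using \<phi> p by (intro strict_mono_fun_size_padded) linarith+
  qed
  then show ?thesis
    using F approx length_monotone_padded[OF \<phi>]
    by (auto simp: xi_iff_approximates_integrals approximates_integrals_padded sobolev_space_def)
qed

theorem theorem4p4:
  fixes p :: real and pr :: "str \<Rightarrow> str \<Rightarrow> str"
  assumes "1 \<le> p"
    and "pairing_function pr"
  shows "polytime_computable_map (sobolev_space 1 p) (xi pr 1 p) (Lp_space p) (xi pr 0 p) (\<lambda>F. F)"
proof -
  obtain k :: nat where k: "p \<le> real k"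
    using real_arch_simple by blast
  define m where "m = max (6 * k) (length (triple pr [] one_code (ones 0)))"
  have "xi pr 0 p (padded k m \<phi>) F" if "xi pr 1 p \<phi> F" for \<phi> F
    using assms(1) k that by (rule xi_0_padded) (simp_all add: m_def)
  moreover have "computes_within (compile (pad_program k m)) \<phi> [a] (padded k m \<phi> a)
      (pad_time k m (fun_size \<phi>) (length a))" if "xi pr 1 p \<phi> F" for \<phi> F a
    using that by (intro pad_program_computes_padded) (simp add: xi_def)
  moreover have "F \<in> Lp_space p" if "F \<in> sobolev_space 1 p" for F
    using that by (simp add: sobolev_space_def)
  ultimately show ?thesis
    unfolding polytime_computable_map_def
    using wf_machine_compile second_order_poly_pad_time by blast
qed

end
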